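(* Let $\mathcal{K}$ be a class of finite $\mathcal{R}$-structures and let $\mathbf{A}\in\mathcal{K}$. Suppose $\mathcal{K}$ is closed under forming the $n$-pinch construction over $\mathbf{A}$ and under taking disjoint unions. Then $\mathbb{H}^{\gets}_{\mathcal{K}}(\mathbf{A})=\mathcal{K}\cap\operatorname{Mod}(\phi)$ for some first-order sentence $\phi$ if and only if there is a finite conjunction of anti-identities $\psi$ such that $\mathbb{H}^{\gets}_{\mathcal{K}}(\mathbf{A})=\mathcal{K}\cap\operatorname{Mod}(\psi)$.
   Context: $\mathcal{R}=\{R_1,\dots,R_m\}$ is a finite purely relational signature, $R_i$ of arity $r_i\ge1$; all structures are finite. $\mathbb{H}^{\gets}_{\mathcal{K}}(\mathbf{A})$ is the class of all $\mathbf{B}\in\mathcal{K}$ admitting a homomorphism to $\mathbf{A}$. An anti-identity is a sentence $\forall x_1,\dots,x_n\,[\neg\alpha_1\vee\dots\vee\neg\alpha_k]$ with $n\ge0$, $k\ge1$, each $\alpha_i$ atomic in $x_1,\dots,x_n$. For $n\in\mathbb{N}$, the $n$-link is $\mathbf{L}_n=\langle\{0,1,\dots,n\};R_1^{\mathbf{L}_n},\dots,R_m^{\mathbf{L}_n}\rangle$ with $R_i^{\mathbf{L}_n}=\bigcup_{j=1}^n\{j-1,j\}^{r_i}$. On the product structure $\mathbf{L}_n\times\mathbf{A}\times\mathbf{A}$ define the equivalence $(i,a,b)\sim_n(i',a',b')$ iff either they are equal, or $i=i'=0$ and $a=a'$, or $i=i'=n$ and $b=b'$. The $n$-pinch over $\mathbf{A}$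 is the quotient structure $\mathbf{P}_n(\mathbf{A})=(\mathbf{L}_n\times\mathbf{A}\times\mathbf{A})/\sim_n$ (a tuple of classes is in a relation iff some choice of representatives is in the relation of the product). $\mathbf{B}_R$ and $\mathbf{B}_L$ are the substructures of $\mathbf{P}_n(\mathbf{A})$ induced by $\{(k,a,b)/\sim_n : k\ne0\}$ and $\{(k,a,b)/\sim_n: k\ne n\}$ respectively. $\mathcal{K}$ is closed under forming the $n$-pinch construction over a class $\mathcal{F}$ if for every $n\in\mathbb{N}$ and every $\mathbf{F}\in\mathcal{F}$, $\mathbf{P}_n(\mathbf{F})$ and its substructures $\mathbf{B}_R$, $\mathbf{B}_L$ belong to $\mathcal{K}$. Closed under disjoint unions means the disjoint union of any two members of $\mathcal{K}$ is in $\mathcal{K}$. *)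

theory Defs
  imports Main
begin

text \<open>Relational signatures and structures. Tuples are lists, and the interpretation of a symbol
  that does not belong to the signature is required to be empty, so that structures over the
  same signature are equal iff they agree on the universe and on all symbols. Structures may be empty.\<close>

record 'r signature =
  symbols :: "'r set"
  arity :: "'r \<Rightarrow> nat"

definition finite_relational_signature :: "'r signature \<Rightarrow> bool" where
  "finite_relational_signature S \<longleftrightarrow> finite (symbols S) \<and> (\<forall>R\<in>symbols S. 1 \<le> arity S R)"

record ('r, 'u) relstruct =
  universe :: "'u set"
  interp :: "'r \<Rightarrow> 'u list set"

definition tuples :: "'u set \<Rightarrow> nat \<Rightarrow> 'u list set" where
  "tuples U k = {xs. length xs = k \<and> set xs \<subseteq> U}"

definition finite_structure :: "'r signature \<Rightarrow> ('r, 'u) relstruct \<Rightarrow> bool" where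
  "finite_structure S B \<longleftrightarrow>
     finite (universe B) \<and>
     (\<forall>R\<in>symbols S. interp B R \<subseteq> tuples (universe B) (arity S R)) \<and>
     (\<forall>R. R \<notin> symbols S \<longrightarrow> interp B R = {})"

definition homomorphism ::
    "'r signature \<Rightarrow> ('u \<Rightarrow> 'v) \<Rightarrow> ('r, 'u) relstruct \<Rightarrow> ('r, 'v) relstruct \<Rightarrow> bool" where
  "homomorphism S h B C \<longleftrightarrow>
     h ` universe B \<subseteq> universe C \<and>
     (\<forall>R\<in>symbols S. \<forall>xs\<in>interp B R. map h xs \<in> interp C R)"

definition isomorphic :: "'r signature \<Rightarrow> ('r, 'u) relstruct \<Rightarrow> ('r, 'v) relstruct \<Rightarrow> bool" where
  "isomorphic S B C \<longleftrightarrow>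
     (\<exists>f. bij_betw f (universe B) (universe C) \<and>
       (\<forall>R\<in>symbols S. \<forall>xs\<in>tuples (universe B) (arity S R).
          xs \<in> interp B R \<longleftrightarrow> map f xs \<in> interp C R))"

definition hom_class ::
    "'r signature \<Rightarrow> ('r, 'u) relstruct set \<Rightarrow> ('r, 'v) relstruct \<Rightarrow> ('r, 'u) relstruct set" where
  "hom_class S K A = {B \<in> K. \<exists>h. homomorphism S h B A}"

definition induced :: "('r, 'u) relstruct \<Rightarrow> 'u set \<Rightarrow> ('r, 'u) relstruct" where
  "induced B V = \<lparr>universe = universe B \<inter> V, interp = (\<lambda>R. {xs \<in> interp B R. set xs \<subseteq> V})\<rparr>"

definition product :: "('r, 'u) relstruct \<Rightarrow> ('r, 'v) relstruct \<Rightarrow> ('r, 'u \<times> 'v) relstruct" where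
  "product B C =
     \<lparr>universe = universe B \<times> universe C,
      interp = (\<lambda>R. {xs. map fst xs \<in> interp B R \<and> map snd xs \<in> interp C R})\<rparr>"

definition disjoint_union :: "('r, 'u) relstruct \<Rightarrow> ('r, 'v) relstruct \<Rightarrow> ('r, 'u + 'v) relstruct" where
  "disjoint_union B C =
     \<lparr>universe = Inl ` universe B \<union> Inr ` universe C,
      interp = (\<lambda>R. map Inl ` interp B R \<union> map Inr ` interp C R)\<rparr>"

definition quotient_structure ::
    "('r, 'u) relstruct \<Rightarrow> ('u \<times> 'u) set \<Rightarrow> ('r, 'u set) relstruct" where
  "quotient_structure B E =
     \<lparr>universe = universe B // E, interp = (\<lambda>R. map (\<lambda>x. E `` {x}) ` interp B R)\<rparr>"

definition link :: "'r signature \<Rightarrow> nat \<Rightarrow> ('r, nat) relstruct" where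
  "link S n =
     \<lparr>universe = {0..n},
      interp = (\<lambda>R. if R \<in> symbols S then \<Union>j\<in>{1..n}. tuples {j - 1, j} (arity S R) else {})\<rparr>"

definition link_product ::
    "'r signature \<Rightarrow> nat \<Rightarrow> ('r, 'u) relstruct \<Rightarrow> ('r, nat \<times> 'u \<times> 'u) relstruct" where
  "link_product S n A = product (link S n) (product A A)"

definition pinch_rel ::
    "'r signature \<Rightarrow> nat \<Rightarrow> ('r, 'u) relstruct \<Rightarrow> ((nat \<times> 'u \<times> 'u) \<times> (nat \<times> 'u \<times> 'u)) set" where
  "pinch_rel S n A =
     {((i, a, b), (i', a', b')) | i a b i' a' b'.
        (i, a, b) \<in> universe (link_product S n A) \<and> (i', a', b') \<in> universe (link_product S n A) \<and>
        ((i, a, b) = (i', a', b') \<or> (i = 0 \<and> i' = 0 \<and> a = a') \<or> (i = n \<and> i' = n \<and> b = b'))}"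

definition pinch ::
    "'r signature \<Rightarrow> nat \<Rightarrow> ('r, 'u) relstruct \<Rightarrow> ('r, (nat \<times> 'u \<times> 'u) set) relstruct" where
  "pinch S n A = quotient_structure (link_product S n A) (pinch_rel S n A)"

definition pinch_R ::
    "'r signature \<Rightarrow> nat \<Rightarrow> ('r, 'u) relstruct \<Rightarrow> ('r, (nat \<times> 'u \<times> 'u) set) relstruct" where
  "pinch_R S n A = induced (pinch S n A)
     {pinch_rel S n A `` {(k, a, b)} | k a b. (k, a, b) \<in> universe (link_product S n A) \<and> k \<noteq> 0}"

definition pinch_L ::
    "'r signature \<Rightarrow> nat \<Rightarrow> ('r, 'u) relstruct \<Rightarrow> ('r, (nat \<times> 'u \<times> 'u) set) relstruct" where
  "pinch_L S n A = induced (pinch S n A)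
     {pinch_rel S n A `` {(k, a, b)} | k a b. (k, a, b) \<in> universe (link_product S n A) \<and> k \<noteq> n}"

text \<open>A class of finite structures is represented by a set \<open>K\<close> of structures with elements in
  one type \<open>'u\<close>; for infinite \<open>'u\<close> every finite structure has a copy there. The constructions
  above change the element type, so membership of their results in \<open>K\<close> is up to isomorphism.
  (\<open>K\<close> need not be closed under isomorphism; if it is, this is ordinary membership.)\<close>

definition belongs_to ::
    "'r signature \<Rightarrow> ('r, 'v) relstruct \<Rightarrow> ('r, 'u) relstruct set \<Rightarrow> bool" where
  "belongs_to S B K \<longleftrightarrow> (\<exists>C\<in>K. isomorphic S B C)"

text \<open>Here \<open>n\<close> ranges over the positive integers: for \<open>n = 0\<close> the relation \<open>pinch_rel\<close> is in
  general not transitive, so there is no quotient.\<close>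

definition closed_under_pinch ::
    "'r signature \<Rightarrow> ('r, 'u) relstruct set \<Rightarrow> ('r, 'v) relstruct set \<Rightarrow> bool" where
  "closed_under_pinch S K \<F> \<longleftrightarrow>
     (\<forall>n\<ge>1. \<forall>F\<in>\<F>. belongs_to S (pinch S n F) K \<and> belongs_to S (pinch_R S n F) K \<and>
        belongs_to S (pinch_L S n F) K)"

definition closed_under_disjoint_unions ::
    "'r signature \<Rightarrow> ('r, 'u) relstruct set \<Rightarrow> bool" where
  "closed_under_disjoint_unions S K \<longleftrightarrow> (\<forall>B\<in>K. \<forall>C\<in>K. belongs_to S (disjoint_union B C) K)"

lemma equiv_pinch_rel:
  assumes "1 \<le> n"
  shows "equiv (universe (link_product S n A)) (pinch_rel S n A)"
  using assms by (intro equivI refl_onI symI transI) (auto simp: pinch_rel_def)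

text \<open>First-order logic with equality; variables are natural numbers.\<close>

datatype 'r formula =
    Truth
  | Rel 'r "nat list"
  | Eq nat nat
  | Neg "'r formula"
  | Conj "'r formula" "'r formula"
  | Disj "'r formula" "'r formula"
  | Forall nat "'r formula"
  | Exists nat "'r formula"

fun sat :: "('r, 'u) relstruct \<Rightarrow> (nat \<Rightarrow> 'u) \<Rightarrow> 'r formula \<Rightarrow> bool" where
  "sat B e Truth \<longleftrightarrow> True"
| "sat B e (Rel R xs) \<longleftrightarrow> map e xs \<in> interp B R"
| "sat B e (Eq x y) \<longleftrightarrow> e x = e y"
| "sat B e (Neg p) \<longleftrightarrow> \<not> sat B e p"
| "sat B e (Conj p q) \<longleftrightarrow> sat B e p \<and> sat B e q"
| "sat B e (Disj p q) \<longleftrightarrow> sat B e p \<or> sat B e q"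
| "sat B e (Forall x p) \<longleftrightarrow> (\<forall>u\<in>universe B. sat B (e(x := u)) p)"
| "sat B e (Exists x p) \<longleftrightarrow> (\<exists>u\<in>universe B. sat B (e(x := u)) p)"

fun free_vars :: "'r formula \<Rightarrow> nat set" where
  "free_vars Truth = {}"
| "free_vars (Rel R xs) = set xs"
| "free_vars (Eq x y) = {x, y}"
| "free_vars (Neg p) = free_vars p"
| "free_vars (Conj p q) = free_vars p \<union> free_vars q"
| "free_vars (Disj p q) = free_vars p \<union> free_vars q"
| "free_vars (Forall x p) = free_vars p - {x}"
| "free_vars (Exists x p) = free_vars p - {x}"

fun formula_over :: "'r signature \<Rightarrow> 'r formula \<Rightarrow> bool" where
  "formula_over S Truth \<longleftrightarrow> True"
| "formula_over S (Rel R xs) \<longleftrightarrow> R \<in> symbols S \<and> length xs = arity S R"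
| "formula_over S (Eq x y) \<longleftrightarrow> True"
| "formula_over S (Neg p) \<longleftrightarrow> formula_over S p"
| "formula_over S (Conj p q) \<longleftrightarrow> formula_over S p \<and> formula_over S q"
| "formula_over S (Disj p q) \<longleftrightarrow> formula_over S p \<and> formula_over S q"
| "formula_over S (Forall x p) \<longleftrightarrow> formula_over S p"
| "formula_over S (Exists x p) \<longleftrightarrow> formula_over S p"

definition sentence :: "'r signature \<Rightarrow> 'r formula \<Rightarrow> bool" where
  "sentence S p \<longleftrightarrow> formula_over S p \<and> free_vars p = {}"

text \<open>\<open>Mod\<close> is only applied to sentences, whose truth does not depend on the assignment. The
  assignment is not required to take values in the universe, which may be empty.\<close>

definition Mod :: "'r formula \<Rightarrow> ('r, 'u) relstruct set" where
  "Mod p = {B. \<forall>e. sat B e p}"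

definition atomic :: "'r signature \<Rightarrow> 'r formula \<Rightarrow> bool" where
  "atomic S p \<longleftrightarrow> formula_over S p \<and> ((\<exists>R xs. p = Rel R xs) \<or> (\<exists>x y. p = Eq x y))"

fun big_disj :: "'r formula list \<Rightarrow> 'r formula" where
  "big_disj [] = Neg Truth"
| "big_disj [p] = p"
| "big_disj (p # q # ps) = Disj p (big_disj (q # ps))"

fun big_conj :: "'r formula list \<Rightarrow> 'r formula" where
  "big_conj [] = Truth"
| "big_conj [p] = p"
| "big_conj (p # q # ps) = Conj p (big_conj (q # ps))"

definition anti_identity :: "'r signature \<Rightarrow> 'r formula \<Rightarrow> bool" where
  "anti_identity S p \<longleftrightarrow>
     (\<exists>xs \<alpha>s. distinct xs \<and> \<alpha>s \<noteq> [] \<and>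
        (\<forall>\<alpha>\<in>set \<alpha>s. atomic S \<alpha> \<and> free_vars \<alpha> \<subseteq> set xs) \<and>
        p = foldr Forall xs (big_disj (map Neg \<alpha>s)))"

text \<open>The empty conjunction is included; it is needed when every member of the class maps
  to \<open>A\<close>, for example when \<open>A\<close> is a single point with all relations total.\<close>

definition conjunction_of_anti_identities :: "'r signature \<Rightarrow> 'r formula \<Rightarrow> bool" where
  "conjunction_of_anti_identities S p \<longleftrightarrow>
     (\<exists>ps. (\<forall>q\<in>set ps. anti_identity S q) \<and> p = big_conj ps)"

end

theory Submission
  imports Defs "HOL-Combinatorics.Cycles"
begin

text \<open>In the sum of many copies of \<open>B_L\<close> and \<open>B_R\<close>, which maps to \<open>A\<close>, a sentence of quantifier
  rank \<open>q\<close> cannot detect an additional copy of a pinch longer than \<open>2 ^ q\<close>; hence if \<open>\<phi>\<close>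
  defines the class, some pinch maps to \<open>A\<close>. Such a map is a chain of binary
  polymorphisms from a unary map of the first argument to one of the second; on the core of \<open>A\<close> its
  ends become the two projections. Interpolating along the chain shows that arc consistency
  becomes stable after \<open>n\<close> rounds unless it fails, and folding away dominated values then shrinks an
  arc consistent family of sets to singletons, i.e. to a homomorphism. So \<open>n + 1\<close> rounds of arc
  consistency decide the existence of a homomorphism to \<open>A\<close>, failure is witnessed by an induced
  substructure of bounded size, and finitely many anti-identities exclude these.\<close>

section \<open>Arc consistency\<close>

text \<open>\<open>K\<close> need not be closed under substructures or contain all finite
  structures, so preservation theorems do not apply, and \<open>\<phi>\<close> is known to define
  the class only inside \<open>K\<close>. It is therefore tested just once, on two sums that
  \<open>K\<close> is bound to contain up to isomorphism. The outcome, a map from one pinch to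
  \<open>A\<close>, is a property of \<open>A\<close> alone; from there on \<open>K\<close> is
  forgotten and the bound on obstructions holds for all finite structures.

  The two cut pinches are useful because each gluing forgets one coordinate. Once the last level is
  removed, the first coordinate is well defined on classes and projects \<open>B_L\<close> to
  \<open>A\<close>; symmetrically the second projects \<open>B_R\<close>. The whole pinch has no
  evident map, yet it differs from these pieces only in having both ends, and the view of a
  sentence, whose radius doubles with each quantifier, never covers both.

  The core is needed because the map from the pinch gives a chain whose ends are merely unary maps
  of one argument, whereas stability of a round requires that \<open>f 0\<close> return its first
  argument itself.\<close>

text \<open>A chain of binary polymorphisms, consecutive members of which may be mixed coordinatewise;
  this is what a homomorphism from the pinch to \<open>D\<close> amounts to.\<close>

definition poly_chain :: "'r signature \<Rightarrow> nat \<Rightarrow> (nat \<Rightarrow> 'a \<Rightarrow> 'a \<Rightarrow> 'a) \<Rightarrow> ('r, 'a) relstruct \<Rightarrow> bool" where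
  "poly_chain S n f D \<longleftrightarrow>
     (\<forall>i\<le>n. \<forall>a\<in>universe D. \<forall>c\<in>universe D. f i a c \<in> universe D) \<and>
     (\<forall>R\<in>symbols S. \<forall>s\<in>interp D R. \<forall>s'\<in>interp D R. \<forall>i<n. \<forall>us.
        length us = length s \<longrightarrow>
        (\<forall>k<length s. us ! k = f i (s ! k) (s' ! k) \<or> us ! k = f (Suc i) (s ! k) (s' ! k)) \<longrightarrow>
        us \<in> interp D R)"

lemma finite_structureD:
  assumes "finite_structure S B" "R \<in> symbols S" "t \<in> interp B R"
  shows "length t = arity S R" "set t \<subseteq> universe B" "j < length t \<Longrightarrow> t ! j \<in> universe B"
proof -
  show "length t = arity S R" and t: "set t \<subseteq> universe B"
    using assms unfolding finite_structure_def tuples_def by blast+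
  show "j < length t \<Longrightarrow> t ! j \<in> universe B" using t by (meson nth_mem subsetD)
qed

lemma homomorphism_comp:
  assumes "homomorphism S h B C" "homomorphism S h' C D"
  shows "homomorphism S (h' \<circ> h) B D"
  using assms unfolding homomorphism_def by (fastforce simp flip: map_map)

text \<open>\<open>T\<close> lists the values still allowed at each element. A family of empty sets
  passes, so nonemptiness is always asked for separately.\<close>

definition arc_consistent ::
    "'r signature \<Rightarrow> ('r, 'b) relstruct \<Rightarrow> ('r, 'a) relstruct \<Rightarrow> ('b \<Rightarrow> 'a set) \<Rightarrow> bool" where
  "arc_consistent S B D T \<longleftrightarrow>
     (\<forall>R\<in>symbols S. \<forall>t\<in>interp B R. \<forall>j<length t. \<forall>a\<in>T (t ! j).
        \<exists>s\<in>interp D R. length s = length t \<and> s ! j = a \<and> (\<forall>l<length t. s ! l \<in> T (t ! l)))"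

text \<open>The chain of polymorphisms may depend on the element of \<open>B\<close>: it is composed
  with local folding maps in the induction below.\<close>

definition local_chain ::
    "'r signature \<Rightarrow> nat \<Rightarrow> ('r, 'b) relstruct \<Rightarrow> ('r, 'a) relstruct \<Rightarrow> ('b \<Rightarrow> 'a set) \<Rightarrow>
     (nat \<Rightarrow> 'b \<Rightarrow> 'a \<Rightarrow> 'a \<Rightarrow> 'a) \<Rightarrow> bool" where
  "local_chain S n B D T g \<longleftrightarrow>
     (\<forall>b\<in>universe B. \<forall>a\<in>T b. \<forall>c\<in>T b.
        (\<forall>i\<le>n. g i b a c \<in> T b) \<and> g 0 b a c = a \<and> g n b a c = c) \<and>
     (\<forall>R\<in>symbols S. \<forall>t\<in>interp B R. \<forall>s\<in>interp D R. \<forall>s'\<in>interp D R. \<forall>i<n. \<forall>us.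
        length s = length t \<longrightarrow> length s' = length t \<longrightarrow> length us = length t \<longrightarrow>
        (\<forall>l<length t. s ! l \<in> T (t ! l) \<and> s' ! l \<in> T (t ! l) \<and>
           (us ! l = g i (t ! l) (s ! l) (s' ! l) \<or> us ! l = g (Suc i) (t ! l) (s ! l) (s' ! l))) \<longrightarrow>
        us \<in> interp D R)"

lemma poly_chain_mix:
  assumes "poly_chain S n f D" "R \<in> symbols S" "s \<in> interp D R" "s' \<in> interp D R" "i < n" "length us = length s"
    "\<And>k. k < length s \<Longrightarrow> us ! k = f i (s ! k) (s' ! k) \<or> us ! k = f (Suc i) (s ! k) (s' ! k)"
  shows "us \<in> interp D R"
  using assms unfolding poly_chain_def by blast

lemma local_chain_mix:
  assumes "local_chain S n B D T g" "R \<in> symbols S" "t \<in> interp B R" "s \<in> interp D R" "s' \<in> interp D R"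
    "i < n" "length s = length t" "length s' = length t" "length us = length t"
    "\<And>l. l < length t \<Longrightarrow> s ! l \<in> T (t ! l)" "\<And>l. l < length t \<Longrightarrow> s' ! l \<in> T (t ! l)"
    "\<And>l. l < length t \<Longrightarrow>
       us ! l = g i (t ! l) (s ! l) (s' ! l) \<or> us ! l = g (Suc i) (t ! l) (s ! l) (s' ! l)"
  shows "us \<in> interp D R"
  using assms unfolding local_chain_def by blast

section \<open>Dismantling by dominated values\<close>

text \<open>The relational form of domination in dismantlable graphs, relative to the values that
  \<open>T\<close> allows. Only the entry \<open>j\<close> changes, also when \<open>b\<close>
  occurs again in \<open>t\<close>, so replacements can be made one entry at a time.\<close>

definition dominated ::
    "'r signature \<Rightarrow> ('r, 'b) relstruct \<Rightarrow> ('r, 'a) relstruct \<Rightarrow> ('b \<Rightarrow> 'a set) \<Rightarrow> 'b \<Rightarrow> 'a \<Rightarrow> 'a \<Rightarrow> bool" where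
  "dominated S B D T b a d \<longleftrightarrow>
     (\<forall>R\<in>symbols S. \<forall>t\<in>interp B R. \<forall>s\<in>interp D R. \<forall>j<length t.
        length s = length t \<longrightarrow> t ! j = b \<longrightarrow> s ! j = a \<longrightarrow> (\<forall>l<length t. s ! l \<in> T (t ! l)) \<longrightarrow>
        s[j := d] \<in> interp D R)"

text \<open>Moving along the chain, each next polymorphism sends \<open>(a, c)\<close> to an element dominating \<open>a\<close>;
  so if only trivial dominations exist, the first and the second projection agree.\<close>

lemma undominated_singletons:
  assumes B: "finite_structure S B"
    and arc: "arc_consistent S B D T"
    and ch: "local_chain S n B D T g"
    and stiff: "\<And>b a d. b \<in> universe B \<Longrightarrow> a \<in> T b \<Longrightarrow> d \<in> T b \<Longrightarrow> dominated S B D T b a d \<Longrightarrow> a = d"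
    and b: "b \<in> universe B" "a \<in> T b" "c \<in> T b"
  shows "a = c"
proof -
  have "i \<le> n \<Longrightarrow> \<forall>b\<in>universe B. \<forall>a\<in>T b. \<forall>c\<in>T b. g i b a c = a" for i
  proof (induction i)
    case 0
    then show ?case using ch by (simp add: local_chain_def)
  next
    case (Suc i)
    show ?case
    proof (intro ballI)
      fix b a c assume b: "b \<in> universe B" "a \<in> T b" "c \<in> T b"
      let ?d = "g (Suc i) b a c"
      have d: "?d \<in> T b" using ch b Suc.prems by (auto simp: local_chain_def)
      have "dominated S B D T b a ?d"
        unfolding dominated_def
      proof (intro ballI allI impI)
        fix R t s j
        assume R: "R \<in> symbols S" "t \<in> interp B R" "s \<in> interp D R" and j: "j < length t"
          and s: "length s = length t" "t ! j = b" "s ! j = a" "\<forall>l<length t. s ! l \<in> T (t ! l)"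
        obtain s' where s': "s' \<in> interp D R" "length s' = length t" "s' ! j = c"
            "\<forall>l<length t. s' ! l \<in> T (t ! l)"
          using arc R j s b unfolding arc_consistent_def by metis
        \<comment> \<open>Mixing enters here: the entry \<open>j\<close> already uses member
          \<open>Suc i\<close>, all others still use member \<open>i\<close>, which by the induction
          hypothesis returns the entry of \<open>s\<close>.\<close>
        have "(s[j := ?d]) ! l = g i (t ! l) (s ! l) (s' ! l) \<or>
              (s[j := ?d]) ! l = g (Suc i) (t ! l) (s ! l) (s' ! l)" if "l < length t" for l
          using that s s' j Suc.IH Suc.prems finite_structureD(3)[OF B R(1,2) that]
          by (cases "l = j") auto
        then show "s[j := ?d] \<in> interp D R"
          using Suc.prems s s' by (intro local_chain_mix[OF ch R s'(1), of i]) auto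
      qed
      then show "?d = a" using stiff b d by metis
    qed
  qed
  from this[of n] show ?thesis using ch b by (auto simp: local_chain_def)
qed

lemma singletons_hom:
  assumes B: "finite_structure S B" and D: "finite_structure S D"
    and S: "finite_relational_signature S"
    and arc: "arc_consistent S B D T"
    and T: "\<And>b. b \<in> universe B \<Longrightarrow> T b \<noteq> {} \<and> T b \<subseteq> universe D"
    and sing: "\<And>b a c. b \<in> universe B \<Longrightarrow> a \<in> T b \<Longrightarrow> c \<in> T b \<Longrightarrow> a = c"
  shows "\<exists>h. homomorphism S h B D"
proof -
  have "\<forall>b\<in>universe B. \<exists>a. a \<in> T b" using T by blast
  then obtain h where h: "\<And>b. b \<in> universe B \<Longrightarrow> h b \<in> T b" by metis
  have "map h t \<in> interp D R" if R: "R \<in> symbols S" "t \<in> interp B R" for R t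
  proof -
    \<comment> \<open>Arc consistency constrains a tuple only through its entries and says nothing
      about an empty one; positive arities exclude that case.\<close>
    have "0 < length t" using S R finite_structureD(1)[OF B R]
      by (auto simp: finite_relational_signature_def)
    moreover have t: "t ! l \<in> universe B" if "l < length t" for l
      using finite_structureD(3)[OF B R] that by simp
    ultimately obtain s where s: "s \<in> interp D R" "length s = length t" "\<forall>l<length t. s ! l \<in> T (t ! l)"
      using arc R h unfolding arc_consistent_def by metis
    have "s = map h t"
    proof (rule nth_equalityI)
      show "s ! l = map h t ! l" if "l < length s" for l
        using s sing[OF t _ h[OF t]] that by simp
    qed (use s in simp)
    then show ?thesis using s by simp
  qed
  then show ?thesis using T h unfolding homomorphism_def by blast
qed

text \<open>Domination replaces one entry, so the replaced prefix grows entry by entry. The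
  intermediate tuples stay inside \<open>T\<close> because \<open>d\<close> is allowed at
  \<open>b\<close>, and domination applies again.\<close>

lemma fold_dominated:
  assumes dom: "dominated S B D T b a d" and d: "d \<in> T b"
    and R: "R \<in> symbols S" "t \<in> interp B R" "s \<in> interp D R"
    and s: "length s = length t" "\<forall>l<length t. s ! l \<in> T (t ! l)"
    and us: "length us = length t"
      "\<forall>l<length t. us ! l = (if t ! l = b \<and> s ! l = a then d else s ! l)"
  shows "us \<in> interp D R"
proof -
  have "m \<le> length t \<Longrightarrow> take m us @ drop m s \<in> interp D R" for m
  proof (induction m)
    case 0
    then show ?case using R by simp
  next
    case (Suc m)
    let ?v = "take m us @ drop m s"
    have v: "?v \<in> interp D R" "length ?v = length t" using Suc s us by auto
    have nth: "?v ! l = (if l < m then us ! l else s ! l)" if "l < length t" for l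
      using that Suc.prems s us by (simp add: nth_append)
    have "take (Suc m) us @ drop (Suc m) s = ?v[m := us ! m]"
      using Suc.prems s us
      by (intro nth_equalityI) (auto simp: nth_append nth_list_update less_Suc_eq)
    moreover have "?v[m := us ! m] \<in> interp D R"
    proof (cases "t ! m = b \<and> s ! m = a")
      case True
      have "\<forall>l<length t. ?v ! l \<in> T (t ! l)"
        using nth s us d by auto
      then show ?thesis
        using dom R v nth True Suc.prems us unfolding dominated_def
        by (metis Suc_le_eq less_irrefl)
    next
      case False
      then have "?v[m := us ! m] = ?v" using nth[of m] us Suc.prems
        by (metis Suc_le_eq less_irrefl list_update_id)
      then show ?thesis using v by simp
    qed
    ultimately show ?case by simp
  qed
  from this[of "length t"] show ?thesis using s us by simp
qed

text \<open>Induction on the total size of \<open>T\<close>. A nontrivial domination of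
  \<open>a\<close> by \<open>d\<close> at \<open>b\<close> gives a retraction \<open>\<rho>\<close>
  onto the family without \<open>a\<close>. Supporting tuples can be pushed through
  \<open>\<rho>\<close>, and the chain followed by \<open>\<rho>\<close> is a chain of the same
  length whose ends remain projections, since \<open>\<rho>\<close> fixes the remaining values. If
  no such domination exists, only singletons are left.\<close>

lemma arc_consistent_hom:
  assumes S: "finite_relational_signature S"
    and B: "finite_structure S B" and D: "finite_structure S D"
  shows "\<lbrakk>arc_consistent S B D T; local_chain S n B D T g;
      \<And>b. b \<in> universe B \<Longrightarrow> T b \<noteq> {} \<and> T b \<subseteq> universe D\<rbrakk> \<Longrightarrow> \<exists>h. homomorphism S h B D"
proof (induction "\<Sum>b\<in>universe B. card (T b)" arbitrary: T g rule: less_induct)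
  case less
  note arc = less.prems(1) and ch = less.prems(2) and T = less.prems(3)
  show ?case
  proof (cases "\<exists>b a d. b \<in> universe B \<and> a \<in> T b \<and> d \<in> T b \<and> dominated S B D T b a d \<and> a \<noteq> d")
    case False
    then show ?thesis
      using singletons_hom[OF B D S arc T] undominated_singletons[OF B arc ch] by metis
  next
    case True
    then obtain b a d where b: "b \<in> universe B" "a \<in> T b" "d \<in> T b" "a \<noteq> d"
      and dom: "dominated S B D T b a d" by blast
    define \<rho> where "\<rho> = (\<lambda>b' x. if b' = b \<and> x = a then d else x)"
    define T' where "T' = T(b := T b - {a})"
    define g' where "g' = (\<lambda>i b' x y. \<rho> b' (g i b' x y))"
    have sub: "x \<in> T b'" if "x \<in> T' b'" for x b' using that by (auto simp: T'_def split: if_splits)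
    have \<rho>T: "\<rho> b' x \<in> T' b'" if "x \<in> T b'" for x b'
      using that b by (auto simp: T'_def \<rho>_def)
    have \<rho>id: "\<rho> b' x = x" if "x \<in> T' b'" for x b'
      using that by (auto simp: T'_def \<rho>_def split: if_splits)
    have fold: "us \<in> interp D R"
      if "R \<in> symbols S" "t \<in> interp B R" "s \<in> interp D R" "length s = length t"
        "\<forall>l<length t. s ! l \<in> T (t ! l)" "length us = length t"
        "\<forall>l<length t. us ! l = \<rho> (t ! l) (s ! l)" for R t s us
      using fold_dominated[OF dom b(3) that(1-6)] that(7) by (simp add: \<rho>_def)
    have fin: "finite (T b')" if "b' \<in> universe B" for b'
      using T[OF that] D by (meson finite_structure_def finite_subset)
    have "(\<Sum>b\<in>universe B. card (T' b)) < (\<Sum>b\<in>universe B. card (T b))"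
    proof (rule sum_strict_mono_ex1)
      show "finite (universe B)" using B by (simp add: finite_structure_def)
      show "\<forall>x\<in>universe B. card (T' x) \<le> card (T x)" using fin by (auto simp: T'_def card_Diff1_le)
      show "\<exists>x\<in>universe B. card (T' x) < card (T x)"
        using b fin[OF b(1)] by (intro bexI[of _ b]) (auto simp: T'_def simp del: card_Diff_insert card_Diff_singleton intro: card_Diff1_less)
    qed
    moreover have "arc_consistent S B D T'"
      unfolding arc_consistent_def
    proof (intro ballI allI impI)
      fix R t j x assume R: "R \<in> symbols S" "t \<in> interp B R" and j: "j < length t" and x: "x \<in> T' (t ! j)"
      obtain s where s: "s \<in> interp D R" "length s = length t" "s ! j = x" "\<forall>l<length t. s ! l \<in> T (t ! l)"
        using arc R j sub[OF x] unfolding arc_consistent_def by metis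
      let ?us = "map (\<lambda>l. \<rho> (t ! l) (s ! l)) [0..<length t]"
      have "?us \<in> interp D R" by (rule fold[OF R s(1,2,4)]) auto
      moreover have "?us ! j = x" using j s \<rho>id[OF x] by simp
      ultimately show "\<exists>s\<in>interp D R. length s = length t \<and> s ! j = x \<and> (\<forall>l<length t. s ! l \<in> T' (t ! l))"
        using s \<rho>T by (intro bexI[of _ ?us]) auto
    qed
    moreover have "local_chain S n B D T' g'"
      unfolding local_chain_def
    proof (intro conjI ballI allI impI)
      fix b' x y i assume "b' \<in> universe B" "x \<in> T' b'" "y \<in> T' b'" "i \<le> n"
      then show "g' i b' x y \<in> T' b'" using ch sub by (auto simp: g'_def local_chain_def intro!: \<rho>T)
    next
      fix b' x y assume "b' \<in> universe B" "x \<in> T' b'" "y \<in> T' b'"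
      then show "g' 0 b' x y = x" "g' n b' x y = y"
        using ch sub \<rho>id by (auto simp: g'_def local_chain_def)
    next
      fix R t s s' i us
      assume R: "R \<in> symbols S" "t \<in> interp B R" "s \<in> interp D R" "s' \<in> interp D R" and i: "i < n"
        and len: "length s = length t" "length s' = length t" "length us = length t"
        and us: "\<forall>l<length t. s ! l \<in> T' (t ! l) \<and> s' ! l \<in> T' (t ! l) \<and>
          (us ! l = g' i (t ! l) (s ! l) (s' ! l) \<or> us ! l = g' (Suc i) (t ! l) (s ! l) (s' ! l))"
      \<comment> \<open>Undoes the fold entry by entry: the mixed tuple of unfolded values lies in
        \<open>D\<close>, and \<open>\<rho>\<close> maps it to \<open>us\<close>.\<close>
      let ?w = "\<lambda>l. if us ! l = g' i (t ! l) (s ! l) (s' ! l)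
        then g i (t ! l) (s ! l) (s' ! l) else g (Suc i) (t ! l) (s ! l) (s' ! l)"
      let ?vs = "map ?w [0..<length t]"
      have st: "s ! l \<in> T (t ! l)" "s' ! l \<in> T (t ! l)" "t ! l \<in> universe B" if "l < length t" for l
        using us sub that finite_structureD(3)[OF B R(1,2)] by blast+
      have "?vs \<in> interp D R"
        by (rule local_chain_mix[OF ch R i len(1,2)]) (use st in auto)
      moreover have "\<forall>l<length t. ?vs ! l \<in> T (t ! l)"
      proof (intro allI impI)
        fix l assume l: "l < length t"
        have "g k (t ! l) (s ! l) (s' ! l) \<in> T (t ! l)" if "k \<le> n" for k
          using ch st[OF l] that unfolding local_chain_def by blast
        then show "?vs ! l \<in> T (t ! l)" using i l by simp
      qed
      moreover have "\<forall>l<length t. us ! l = \<rho> (t ! l) (?vs ! l)"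
      proof (intro allI impI)
        fix l assume l: "l < length t"
        then show "us ! l = \<rho> (t ! l) (?vs ! l)" using us[rule_format, OF l] by (auto simp: g'_def)
      qed
      ultimately show "us \<in> interp D R"
        using fold[OF R(1,2), of ?vs us] len by simp
    qed
    moreover have "T' b' \<noteq> {} \<and> T' b' \<subseteq> universe D" if "b' \<in> universe B" for b'
      using T[OF that] sub \<rho>T by blast
    ultimately show ?thesis using less.hyps by blast
  qed
qed

section \<open>Rounds of arc consistency\<close>

text \<open>These are the values that the root can take when the tree unfolding of \<open>B\<close>
  at \<open>b\<close> to depth \<open>k\<close> is mapped to \<open>D\<close>. Accordingly only the
  other entries of a supporting tuple are confined to the previous round; the entry \<open>j\<close>
  is the value on trial. That the rounds shrink is a lemma, \<open>ac_Suc_subset\<close>.\<close>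

fun ac :: "'r signature \<Rightarrow> ('r, 'b) relstruct \<Rightarrow> ('r, 'a) relstruct \<Rightarrow> nat \<Rightarrow> 'b \<Rightarrow> 'a set" where
  "ac S B D 0 b = universe D"
| "ac S B D (Suc k) b = {a \<in> universe D. \<forall>R\<in>symbols S. \<forall>t\<in>interp B R. \<forall>j<length t. t ! j = b \<longrightarrow>
     (\<exists>s\<in>interp D R. s ! j = a \<and> (\<forall>l<length t. l \<noteq> j \<longrightarrow> s ! l \<in> ac S B D k (t ! l)))}"

lemma ac_subset: "ac S B D k b \<subseteq> universe D"
  by (cases k) auto

lemma ac_SucI:
  assumes "a \<in> universe D"
    and "\<And>R t j. R \<in> symbols S \<Longrightarrow> t \<in> interp B R \<Longrightarrow> j < length t \<Longrightarrow> t ! j = b \<Longrightarrow>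
      \<exists>s\<in>interp D R. s ! j = a \<and> (\<forall>l<length t. l \<noteq> j \<longrightarrow> s ! l \<in> ac S B D k (t ! l))"
  shows "a \<in> ac S B D (Suc k) b"
  unfolding ac.simps(2) using assms by blast

lemma ac_SucE:
  assumes "a \<in> ac S B D (Suc k) b" "R \<in> symbols S" "t \<in> interp B R" "j < length t" "t ! j = b"
  obtains s where "s \<in> interp D R" "s ! j = a" "\<And>l. l < length t \<Longrightarrow> l \<noteq> j \<Longrightarrow> s ! l \<in> ac S B D k (t ! l)"
  using assms unfolding ac.simps(2) by blast

declare ac.simps(2) [simp del]

lemma ac_Suc_subset: "ac S B D (Suc k) b \<subseteq> ac S B D k b"
proof (induction k arbitrary: b)
  case 0
  then show ?case using ac_subset by simp
next
  case (Suc k)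
  show ?case
  proof
    fix a assume a: "a \<in> ac S B D (Suc (Suc k)) b"
    show "a \<in> ac S B D (Suc k) b"
    proof (rule ac_SucI)
      show "a \<in> universe D" using a by (rule subsetD[OF ac_subset])
      fix R t j assume *: "R \<in> symbols S" "t \<in> interp B R" "j < length t" "t ! j = b"
      show "\<exists>s\<in>interp D R. s ! j = a \<and> (\<forall>l<length t. l \<noteq> j \<longrightarrow> s ! l \<in> ac S B D k (t ! l))"
        by (rule ac_SucE[OF a *]) (use Suc.IH in blast)
    qed
  qed
qed

lemma ac_poly_closed:
  assumes B: "finite_structure S B" and D: "finite_structure S D"
    and f: "poly_chain S n f D" and i: "i \<le> n" and n: "1 \<le> n"
  shows "p \<in> ac S B D k b \<Longrightarrow> q \<in> ac S B D k b \<Longrightarrow> f i p q \<in> ac S B D k b"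
proof (induction k arbitrary: b p q)
  case 0
  then show ?case using f i by (auto simp: poly_chain_def)
next
  case (Suc k)
  have "\<exists>s\<in>interp D R. s ! j = f i p q \<and> (\<forall>l<length t. l \<noteq> j \<longrightarrow> s ! l \<in> ac S B D k (t ! l))"
    if R: "R \<in> symbols S" "t \<in> interp B R" and j: "j < length t" "t ! j = b" for R t j
  proof -
    obtain s where s: "s \<in> interp D R" "s ! j = p" "\<forall>l<length t. l \<noteq> j \<longrightarrow> s ! l \<in> ac S B D k (t ! l)"
      using ac_SucE[OF Suc.prems(1) R j] by metis
    obtain s' where s': "s' \<in> interp D R" "s' ! j = q" "\<forall>l<length t. l \<noteq> j \<longrightarrow> s' ! l \<in> ac S B D k (t ! l)"
      using ac_SucE[OF Suc.prems(2) R j] by metis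
    have len: "length s = length t" "length s' = length t"
      using finite_structureD(1)[OF B R] finite_structureD(1)[OF D R(1)] s(1) s'(1) by simp_all
    let ?us = "map (\<lambda>l. f i (s ! l) (s' ! l)) [0..<length t]"
    \<comment> \<open>A chain only speaks of pairs \<open>i\<close>, \<open>Suc i\<close> with
      \<open>i < n\<close>, so its last member is reached as the upper half of the pair below
      it.\<close>
    have "i < n \<or> (i = Suc (i - 1) \<and> i - 1 < n)" using i n by auto
    then have "?us \<in> interp D R"
    proof
      assume "i < n"
      then show ?thesis
        by (rule poly_chain_mix[OF f R(1) s(1) s'(1)]) (use len in auto)
    next
      assume *: "i = Suc (i - 1) \<and> i - 1 < n"
      then have "\<forall>l<length s. ?us ! l = f (Suc (i - 1)) (s ! l) (s' ! l)" using len by simp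
      then show ?thesis
        by (intro poly_chain_mix[OF f R(1) s(1) s'(1), of "i - 1"]) (use len * in auto)
    qed
    then show ?thesis using s s' j Suc.IH by (intro bexI[of _ ?us]) auto
  qed
  moreover have "f i p q \<in> universe D"
    using f i Suc.prems ac_subset unfolding poly_chain_def by (metis subsetD)
  ultimately show ?case by (rule ac_SucI[rotated])
qed

text \<open>At level \<open>m\<close> the chain interpolates between the second projection (\<open>m = 0\<close>)
  and the first one (\<open>m = n\<close>), where the conclusion says that level \<open>n\<close> is already stable.\<close>

lemma ac_interpolate:
  assumes B: "finite_structure S B" and D: "finite_structure S D"
    and f: "poly_chain S n f D"
    and fn: "\<And>a c. a \<in> universe D \<Longrightarrow> c \<in> universe D \<Longrightarrow> f n a c = c"
  shows "m \<le> n \<Longrightarrow> p \<in> ac S B D m b \<Longrightarrow> q \<in> ac S B D (Suc m) b \<Longrightarrow> f (n - m) p q \<in> ac S B D (Suc m) b"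
proof (induction m arbitrary: b p q)
  case 0
  then show ?case using fn[of p q] subsetD[OF ac_subset 0(3)] by simp
next
  case (Suc m)
  have eq: "n - m = Suc (n - Suc m)" "n - Suc m < n" using Suc.prems by auto
  have "\<exists>s\<in>interp D R. s ! j = f (n - Suc m) p q \<and> (\<forall>l<length t. l \<noteq> j \<longrightarrow> s ! l \<in> ac S B D (Suc m) (t ! l))"
    if R: "R \<in> symbols S" "t \<in> interp B R" and j: "j < length t" "t ! j = b" for R t j
  proof -
    obtain s where s: "s \<in> interp D R" "s ! j = p" "\<forall>l<length t. l \<noteq> j \<longrightarrow> s ! l \<in> ac S B D m (t ! l)"
      using ac_SucE[OF Suc.prems(2) R j] by metis
    obtain s' where s': "s' \<in> interp D R" "s' ! j = q"
        "\<forall>l<length t. l \<noteq> j \<longrightarrow> s' ! l \<in> ac S B D (Suc m) (t ! l)"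
      using ac_SucE[OF Suc.prems(3) R j] by metis
    have len: "length s = length t" "length s' = length t"
      using finite_structureD(1)[OF B R] finite_structureD(1)[OF D R(1)] s(1) s'(1) by simp_all
    \<comment> \<open>Only the entry \<open>j\<close> takes a step along the chain; the others use
      the member of level \<open>m\<close>, which the induction hypothesis places in round
      \<open>Suc m\<close>. One link is spent per round, so a chain of length \<open>n\<close>
      yields stability after \<open>n\<close> rounds.\<close>
    let ?us = "map (\<lambda>l. if l = j then f (n - Suc m) (s ! l) (s' ! l) else f (n - m) (s ! l) (s' ! l)) [0..<length t]"
    have "\<forall>l<length s. ?us ! l = f (n - Suc m) (s ! l) (s' ! l) \<or> ?us ! l = f (Suc (n - Suc m)) (s ! l) (s' ! l)"
      using len eq(1) by simp
    then have "?us \<in> interp D R"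
      using len by (intro poly_chain_mix[OF f R(1) s(1) s'(1) eq(2)]) auto
    moreover have "\<forall>l<length t. l \<noteq> j \<longrightarrow> ?us ! l \<in> ac S B D (Suc m) (t ! l)"
      using Suc.IH Suc.prems(1) s(3) s'(3) by simp
    ultimately show ?thesis using s s' j by (intro bexI[of _ ?us]) auto
  qed
  moreover have "f (n - Suc m) p q \<in> universe D"
    using f Suc.prems ac_subset diff_le_self unfolding poly_chain_def by (metis subsetD)
  ultimately show ?case by (rule ac_SucI[rotated])
qed

lemma ac_nonempty_hom:
  assumes S: "finite_relational_signature S"
    and B: "finite_structure S B" and D: "finite_structure S D"
    and f: "poly_chain S n f D" and n: "1 \<le> n"
    and f0: "\<And>a c. a \<in> universe D \<Longrightarrow> c \<in> universe D \<Longrightarrow> f 0 a c = a"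
    and fn: "\<And>a c. a \<in> universe D \<Longrightarrow> c \<in> universe D \<Longrightarrow> f n a c = c"
    and ne: "\<And>b. b \<in> universe B \<Longrightarrow> ac S B D (Suc n) b \<noteq> {}"
  shows "\<exists>h. homomorphism S h B D"
proof (rule arc_consistent_hom[OF S B D, where T = "ac S B D n" and g = "\<lambda>i b. f i" and n = n])
  have stable: "ac S B D (Suc n) b = ac S B D n b" if b: "b \<in> universe B" for b
  proof
    show "ac S B D n b \<subseteq> ac S B D (Suc n) b"
    proof
      fix p assume p: "p \<in> ac S B D n b"
      \<comment> \<open>Any survivor of round \<open>Suc n\<close> will do, because
        \<open>f 0\<close> returns \<open>p\<close> and forgets it: one survivor saves every value
        of round \<open>n\<close>.\<close>
      obtain q where q: "q \<in> ac S B D (Suc n) b" using ne[OF b] by blast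
      have "f (n - n) p q \<in> ac S B D (Suc n) b"
        using ac_interpolate[OF B D f fn, of n p b q] p q by blast
      moreover have "f 0 p q = p" using f0 p q ac_subset[of S B D] by blast
      ultimately show "p \<in> ac S B D (Suc n) b" by simp
    qed
  qed (rule ac_Suc_subset)
  show "arc_consistent S B D (ac S B D n)"
    unfolding arc_consistent_def
  proof (intro ballI allI impI)
    fix R t j a assume R: "R \<in> symbols S" "t \<in> interp B R" and j: "j < length t" and a: "a \<in> ac S B D n (t ! j)"
    have "a \<in> ac S B D (Suc n) (t ! j)" using a stable finite_structureD(3)[OF B R j] by blast
    then obtain s where s: "s \<in> interp D R" "s ! j = a" "\<forall>l<length t. l \<noteq> j \<longrightarrow> s ! l \<in> ac S B D n (t ! l)"
      using ac_SucE[OF _ R j refl] by metis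
    then have "\<forall>l<length t. s ! l \<in> ac S B D n (t ! l)" using a by metis
    moreover have "length s = length t"
      using finite_structureD(1)[OF B R] finite_structureD(1)[OF D R(1) s(1)] by simp
    ultimately show "\<exists>s\<in>interp D R. length s = length t \<and> s ! j = a \<and> (\<forall>l<length t. s ! l \<in> ac S B D n (t ! l))"
      using s by blast
  qed
  show "local_chain S n B D (ac S B D n) (\<lambda>i b. f i)"
    unfolding local_chain_def
  proof (intro conjI ballI allI impI)
    fix b a c i assume "a \<in> ac S B D n b" "c \<in> ac S B D n b" "i \<le> n"
    then show "f i a c \<in> ac S B D n b" using ac_poly_closed[OF B D f _ n] by blast
  next
    fix b a c assume "a \<in> ac S B D n b" "c \<in> ac S B D n b"
    then have "a \<in> universe D" "c \<in> universe D" by (simp_all add: subsetD[OF ac_subset])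
    then show "f 0 a c = a" "f n a c = c" using f0 fn by blast+
  next
    fix R t s s' i us
    assume "R \<in> symbols S" "s \<in> interp D R" "s' \<in> interp D R" "i < n" "length s = length t" "length us = length t"
      and "\<forall>l<length t. s ! l \<in> ac S B D n (t ! l) \<and> s' ! l \<in> ac S B D n (t ! l) \<and>
        (us ! l = f i (s ! l) (s' ! l) \<or> us ! l = f (Suc i) (s ! l) (s' ! l))"
    then show "us \<in> interp D R" using poly_chain_mix[OF f, of R s s' i us] by presburger
  qed
  show "ac S B D n b \<noteq> {} \<and> ac S B D n b \<subseteq> universe D" if "b \<in> universe B" for b
    using stable[OF that] ne[OF that] ac_subset by metis
qed

section \<open>Bounded obstructions\<close>

lemma ac_antimono:
  assumes "\<And>R. interp B R \<subseteq> interp B' R"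
  shows "ac S B' D k b \<subseteq> ac S B D k b"
proof (induction k arbitrary: b)
  case (Suc k)
  show ?case
  proof
    fix a assume a: "a \<in> ac S B' D (Suc k) b"
    show "a \<in> ac S B D (Suc k) b"
    proof (rule ac_SucI)
      show "a \<in> universe D" using a by (rule subsetD[OF ac_subset])
      fix R t j assume *: "R \<in> symbols S" "t \<in> interp B R" "j < length t" "t ! j = b"
      show "\<exists>s\<in>interp D R. s ! j = a \<and> (\<forall>l<length t. l \<noteq> j \<longrightarrow> s ! l \<in> ac S B D k (t ! l))"
        by (rule ac_SucE[OF a *(1) _ *(3,4)]) (use assms *(2) Suc.IH in blast)+
    qed
  qed
qed simp

lemma hom_in_ac:
  assumes h: "homomorphism S h B D" and B: "\<And>R t. R \<in> symbols S \<Longrightarrow> t \<in> interp B R \<Longrightarrow> set t \<subseteq> universe B"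
  shows "b \<in> universe B \<Longrightarrow> h b \<in> ac S B D k b"
proof (induction k arbitrary: b)
  case 0
  then show ?case using h by (auto simp: homomorphism_def)
next
  case (Suc k)
  have "\<exists>s\<in>interp D R. s ! j = h b \<and> (\<forall>l<length t. l \<noteq> j \<longrightarrow> s ! l \<in> ac S B D k (t ! l))"
    if R: "R \<in> symbols S" "t \<in> interp B R" and j: "j < length t" "t ! j = b" for R t j
  proof (rule bexI)
    show "map h t \<in> interp D R" using h R by (auto simp: homomorphism_def)
    show "map h t ! j = h b \<and> (\<forall>l<length t. l \<noteq> j \<longrightarrow> map h t ! l \<in> ac S B D k (t ! l))"
      using j Suc.IH B[OF R] by (auto simp: subset_iff)
  qed
  moreover have "h b \<in> universe D" using h Suc.prems by (auto simp: homomorphism_def)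
  ultimately show ?case by (rule ac_SucI[rotated])
qed

text \<open>Size of a refutation of depth \<open>k\<close>: the element itself and, for each of at
  most \<open>d\<close> lost values, one unsupported tuple of at most \<open>r\<close> entries, each
  with its own refutation of depth one less.\<close>

fun ac_bound :: "nat \<Rightarrow> nat \<Rightarrow> nat \<Rightarrow> nat" where
  "ac_bound d r 0 = 1"
| "ac_bound d r (Suc k) = Suc (d * (r * ac_bound d r k))"

text \<open>A value is lost because of a single tuple, and that tuple fails because of what its
  entries lost one round earlier. One such tuple per lost value, taken recursively, spans a part of
  \<open>B\<close> in which the same values are lost.\<close>

lemma ac_local:
  fixes B :: "('r, 'b) relstruct" and D :: "('r, 'a) relstruct"
  assumes B: "finite_structure S B" and D: "finite_structure S D"
    and r: "\<And>R. R \<in> symbols S \<Longrightarrow> arity S R \<le> r"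
  shows "b \<in> universe B \<Longrightarrow> \<exists>V\<subseteq>universe B. b \<in> V \<and> card V \<le> ac_bound (card (universe D)) r k \<and>
           ac S (induced B V) D k b \<subseteq> ac S B D k b"
proof (induction k arbitrary: b)
  case 0
  then show ?case by (intro exI[of _ "{b}"]) auto
next
  case (Suc k)
  let ?N = "ac_bound (card (universe D)) r k"
  have finB: "finite (universe B)" using B by (simp add: finite_structure_def)
  from Suc.IH have "\<forall>b. \<exists>V. b \<in> universe B \<longrightarrow> V \<subseteq> universe B \<and> b \<in> V \<and> card V \<le> ?N \<and>
      ac S (induced B V) D k b \<subseteq> ac S B D k b" by blast
  then obtain W where W: "\<And>b. b \<in> universe B \<Longrightarrow> W b \<subseteq> universe B \<and> b \<in> W b \<and> card (W b) \<le> ?N \<and>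
      ac S (induced B (W b)) D k b \<subseteq> ac S B D k b" by metis
  have "\<forall>a. \<exists>t R j. a \<in> universe D - ac S B D (Suc k) b \<longrightarrow>
      R \<in> symbols S \<and> t \<in> interp B R \<and> j < length t \<and> t ! j = b \<and>
      \<not> (\<exists>s\<in>interp D R. s ! j = a \<and> (\<forall>l<length t. l \<noteq> j \<longrightarrow> s ! l \<in> ac S B D k (t ! l)))"
    unfolding ac.simps(2) by blast
  then obtain t R j where wit: "\<And>a. a \<in> universe D - ac S B D (Suc k) b \<Longrightarrow>
      R a \<in> symbols S \<and> t a \<in> interp B (R a) \<and> j a < length (t a) \<and> t a ! j a = b \<and>
      \<not> (\<exists>s\<in>interp D (R a). s ! j a = a \<and> (\<forall>l<length (t a). l \<noteq> j a \<longrightarrow> s ! l \<in> ac S B D k (t a ! l)))"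
    by metis
  define X where "X = universe D - ac S B D (Suc k) b"
  define V where "V = insert b (\<Union>a\<in>X. \<Union>c\<in>set (t a). W c)"
  have tB: "set (t a) \<subseteq> universe B" "length (t a) \<le> r" if "a \<in> X" for a
    using wit[of a] that finite_structureD[OF B] r unfolding X_def by metis+
  have finX: "finite X" using D by (simp add: X_def finite_structure_def)
  have VB: "V \<subseteq> universe B" using Suc.prems W tB by (fastforce simp: V_def)
  have "card (\<Union>c\<in>set (t a). W c) \<le> r * ?N" if "a \<in> X" for a
  proof -
    have "card (\<Union>c\<in>set (t a). W c) \<le> (\<Sum>c\<in>set (t a). card (W c))" by (rule card_UN_le) simp
    also have "\<dots> \<le> (\<Sum>c\<in>set (t a). ?N)" using W tB[OF that] by (intro sum_mono) auto
    also have "\<dots> \<le> r * ?N"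
      using tB(2)[OF that] card_length[of "t a"] by simp
    finally show ?thesis .
  qed
  then have "(\<Sum>a\<in>X. card (\<Union>c\<in>set (t a). W c)) \<le> (\<Sum>a\<in>X. r * ?N)" by (rule sum_mono)
  also have "\<dots> \<le> card (universe D) * (r * ?N)"
    using D by (auto simp: X_def finite_structure_def intro!: mult_le_mono1 card_mono)
  finally have "card (\<Union>a\<in>X. \<Union>c\<in>set (t a). W c) \<le> card (universe D) * (r * ?N)"
    using card_UN_le[OF finX, of "\<lambda>a. \<Union>c\<in>set (t a). W c"] by linarith
  then have "card V \<le> ac_bound (card (universe D)) r (Suc k)"
    unfolding V_def by (intro card_insert_le_m1) simp_all
  moreover have "ac S (induced B V) D (Suc k) b \<subseteq> ac S B D (Suc k) b"
  proof
    fix a assume a: "a \<in> ac S (induced B V) D (Suc k) b"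
    show "a \<in> ac S B D (Suc k) b"
    proof (rule ccontr)
      assume "a \<notin> ac S B D (Suc k) b"
      then have aX: "a \<in> X" using a ac_subset[of S "induced B V" D] by (auto simp: X_def)
      have w: "R a \<in> symbols S" "t a \<in> interp B (R a)" "j a < length (t a)" "t a ! j a = b"
        "\<not> (\<exists>s\<in>interp D (R a). s ! j a = a \<and> (\<forall>l<length (t a). l \<noteq> j a \<longrightarrow> s ! l \<in> ac S B D k (t a ! l)))"
        using wit aX unfolding X_def by blast+
      have "set (t a) \<subseteq> V" using W tB[OF aX] aX by (fastforce simp: V_def)
      then have "t a \<in> interp (induced B V) (R a)" using w by (simp add: induced_def)
      then obtain s where s: "s \<in> interp D (R a)" "s ! j a = a"
          "\<forall>l<length (t a). l \<noteq> j a \<longrightarrow> s ! l \<in> ac S (induced B V) D k (t a ! l)"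
        using ac_SucE[OF a w(1) _ w(3,4)] by metis
      have "ac S (induced B V) D k (t a ! l) \<subseteq> ac S B D k (t a ! l)" if "l < length (t a)" for l
      proof -
        have m: "t a ! l \<in> set (t a)" using that by simp
        then have "W (t a ! l) \<subseteq> V" using aX unfolding V_def by blast
        \<comment> \<open>The part chosen for an entry lies inside \<open>V\<close>, and a larger
          part has more tuples, hence eliminates at least as much.\<close>
        then have "ac S (induced B V) D k (t a ! l) \<subseteq> ac S (induced B (W (t a ! l))) D k (t a ! l)"
          by (intro ac_antimono) (auto simp: induced_def)
        then show ?thesis using W[of "t a ! l"] m tB[OF aX] by blast
      qed
      then show False using s w(5) by blast
    qed
  qed
  ultimately show ?case using VB by (intro exI[of _ V]) (auto simp: V_def)
qed

text \<open>The values of a homomorphism survive every round. If all parts as large as a refutation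
  of depth \<open>Suc n\<close> map to \<open>D\<close>, no element of \<open>B\<close> can lose all
  its values by that round.\<close>

lemma bounded_obstructions_chain:
  assumes S: "finite_relational_signature S" and D: "finite_structure S D"
    and f: "poly_chain S n f D" and n: "1 \<le> n"
    and f0: "\<And>a c. a \<in> universe D \<Longrightarrow> c \<in> universe D \<Longrightarrow> f 0 a c = a"
    and fn: "\<And>a c. a \<in> universe D \<Longrightarrow> c \<in> universe D \<Longrightarrow> f n a c = c"
  shows "\<exists>N. \<forall>B :: ('r, 'b) relstruct. finite_structure S B \<longrightarrow>
     (\<forall>V\<subseteq>universe B. card V \<le> N \<longrightarrow> (\<exists>h. homomorphism S h (induced B V) D)) \<longrightarrow>
     (\<exists>h. homomorphism S h B D)"
proof -
  \<comment> \<open>The sum is a common bound for the arities that makes sense for the empty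
    signature too.\<close>
  define r where "r = (\<Sum>R\<in>symbols S. arity S R)"
  have r: "arity S R \<le> r" if "R \<in> symbols S" for R
    using S that unfolding r_def finite_relational_signature_def by (intro member_le_sum) auto
  show ?thesis
  proof (rule exI[of _ "ac_bound (card (universe D)) r (Suc n)"], intro allI impI)
    fix B :: "('r, 'b) relstruct"
    assume B: "finite_structure S B"
      and loc: "\<forall>V\<subseteq>universe B. card V \<le> ac_bound (card (universe D)) r (Suc n) \<longrightarrow>
        (\<exists>h. homomorphism S h (induced B V) D)"
    show "\<exists>h. homomorphism S h B D"
    proof (rule ac_nonempty_hom[OF S B D f n])
      fix b assume b: "b \<in> universe B"
      obtain V where V: "V \<subseteq> universe B" "b \<in> V" "card V \<le> ac_bound (card (universe D)) r (Suc n)"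
          "ac S (induced B V) D (Suc n) b \<subseteq> ac S B D (Suc n) b"
        using ac_local[OF B D r b] by blast
      obtain h where h: "homomorphism S h (induced B V) D" using loc V by blast
      have "h b \<in> ac S (induced B V) D (Suc n) b"
        by (rule hom_in_ac[OF h]) (use V b B in \<open>auto simp: induced_def finite_structure_def tuples_def\<close>)
      then show "ac S B D (Suc n) b \<noteq> {}" using V(4) by blast
    qed (use f0 fn in auto)
  qed
qed

section \<open>Reduction to the core\<close>

text \<open>An injective self-map of a finite set permutes it, so some positive power is the
  identity and the power before it is the inverse. Being a power, the inverse of an endomorphism is
  again an endomorphism.\<close>

lemma funpow_left_inverse:
  assumes "finite C" "inj_on g C" "g ` C \<subseteq> C"
  obtains k where "\<And>a. a \<in> C \<Longrightarrow> g ((g ^^ k) a) = a"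
proof -
  define p where "p = (\<lambda>x. if x \<in> C then g x else x)"
  have "bij_betw g C C" using assms by (simp add: bij_betw_def endo_inj_surj)
  then have "bij_betw p C C" by (subst bij_betw_cong[of _ _ g]) (auto simp: p_def)
  then have "p permutes C" by (rule bij_imp_permutes) (simp add: p_def)
  then have "permutation p" using assms by (auto simp: permutation_permutes)
  then obtain n where n: "p ^^ n = id" "n > 0" using permutation_is_nilpotent by blast
  have pow: "(p ^^ m) a = (g ^^ m) a \<and> (g ^^ m) a \<in> C" if "a \<in> C" for m a
    using that assms(3) by (induction m) (auto simp: p_def)
  have "g ((g ^^ (n - 1)) a) = a" if "a \<in> C" for a
  proof -
    have "g ((g ^^ (n - 1)) a) = (g ^^ n) a" using n by (cases n) auto
    then show ?thesis using pow[OF that, of n] n by simp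
  qed
  then show ?thesis using that by blast
qed

lemma finite_structure_induced:
  "finite_structure S B \<Longrightarrow> finite_structure S (induced B V)"
  by (auto simp: finite_structure_def induced_def tuples_def)

lemma homomorphism_funpow:
  "homomorphism S h B B \<Longrightarrow> homomorphism S (h ^^ k) B B"
proof (induction k)
  case (Suc k)
  then show ?case using homomorphism_comp[of S "h ^^ k" B B h B] unfolding funpow.simps(2) by blast
qed (simp add: homomorphism_def)

lemma poly_chain_diag:
  assumes f: "poly_chain S n f D" and n: "1 \<le> n" and i: "i \<le> n"
  shows "homomorphism S (\<lambda>a. f i a a) D D"
  unfolding homomorphism_def
proof (intro conjI ballI)
  show "(\<lambda>a. f i a a) ` universe D \<subseteq> universe D" using f i by (auto simp: poly_chain_def)
  fix R s assume R: "R \<in> symbols S" and s: "s \<in> interp D R"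
  have "i < n \<or> i = Suc (i - 1) \<and> i - 1 < n" using i n by auto
  then show "map (\<lambda>a. f i a a) s \<in> interp D R"
  proof
    assume "i < n"
    then show ?thesis by (rule poly_chain_mix[OF f R s s]) auto
  next
    assume *: "i = Suc (i - 1) \<and> i - 1 < n"
    show ?thesis
    proof (rule poly_chain_mix[OF f R s s])
      show "i - 1 < n" using * ..
    qed (use * in auto)
  qed
qed

text \<open>A homomorphic image of least size is the core: every endomorphism permutes it, and
  its inverse is a power of it. Precomposing the chain with such powers makes its ends projections.\<close>

lemma core_chain:
  fixes A :: "('r, 'a) relstruct"
  assumes A: "finite_structure S A" and f: "poly_chain S n f A" and n: "1 \<le> n"
    and f0: "\<And>a c. a \<in> universe A \<Longrightarrow> c \<in> universe A \<Longrightarrow> f 0 a c = f 0 a a"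
    and fn: "\<And>a c. a \<in> universe A \<Longrightarrow> c \<in> universe A \<Longrightarrow> f n a c = f n c c"
  obtains D :: "('r, 'a) relstruct" and f' h h'
  where "finite_structure S D" "poly_chain S n f' D"
    "homomorphism S h A D" "homomorphism S h' D A"
    "\<And>a c. a \<in> universe D \<Longrightarrow> c \<in> universe D \<Longrightarrow> f' 0 a c = a"
    "\<And>a c. a \<in> universe D \<Longrightarrow> c \<in> universe D \<Longrightarrow> f' n a c = c"
proof -
  let ?U = "universe A"
  have finU: "finite ?U" using A by (simp add: finite_structure_def)
  have "homomorphism S id A A" by (simp add: homomorphism_def)
  then obtain e where e: "homomorphism S e A A"
    and least: "\<And>e'. homomorphism S e' A A \<Longrightarrow> card (e ` ?U) \<le> card (e' ` ?U)"
    using ex_has_least_nat[of "\<lambda>e. homomorphism S e A A" id "\<lambda>e. card (e ` ?U)"] by auto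
  define C where "C = e ` ?U"
  define D where "D = induced A C"
  have CU: "C \<subseteq> ?U" using e by (auto simp: C_def homomorphism_def)
  have UD: "universe D = C" using CU by (auto simp: D_def induced_def)
  have finC: "finite C" using CU finU by (rule finite_subset)
  have D: "finite_structure S D" unfolding D_def by (rule finite_structure_induced[OF A])
  have incl: "homomorphism S id D A" using CU by (auto simp: homomorphism_def UD D_def induced_def)
  have eD: "homomorphism S e A D"
    unfolding homomorphism_def
  proof (intro conjI ballI)
    show "e ` ?U \<subseteq> universe D" by (simp add: UD C_def)
    fix R t assume R: "R \<in> symbols S" "t \<in> interp A R"
    then have "map e t \<in> interp A R" using e by (simp add: homomorphism_def)
    moreover have "set (map e t) \<subseteq> C" using finite_structureD(2)[OF A R] by (auto simp: C_def)
    ultimately show "map e t \<in> interp D R" by (simp add: D_def induced_def)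
  qed
  \<comment> \<open>\<open>h\<close> after \<open>e\<close> is an endomorphism too, so collapsing
    points of \<open>C\<close> would contradict the least size of the image of
    \<open>e\<close>.\<close>
  have inj: "inj_on h C" if "homomorphism S h A A" for h
  proof -
    have "card C \<le> card ((h \<circ> e) ` ?U)"
      unfolding C_def by (rule least[OF homomorphism_comp[OF e that]])
    then have "card (h ` C) = card C"
      using card_image_le[OF finC, of h] by (simp add: C_def image_comp)
    then show ?thesis by (rule eq_card_imp_inj_on[OF finC])
  qed
  have inv: "\<exists>\<sigma>. homomorphism S \<sigma> D D \<and> (\<forall>a\<in>C. e (f i (\<sigma> a) (\<sigma> a)) = a)" if i: "i \<le> n" for i
  proof -
    let ?g = "e \<circ> (\<lambda>a. f i a a)"
    have gA: "homomorphism S ?g A A" by (rule homomorphism_comp[OF poly_chain_diag[OF f n i] e])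
    have gD: "homomorphism S ?g D D"
      using homomorphism_comp[OF incl homomorphism_comp[OF poly_chain_diag[OF f n i] eD]] by simp
    then have "?g ` C \<subseteq> C" unfolding homomorphism_def UD by blast
    then obtain k where k: "\<And>a. a \<in> C \<Longrightarrow> ?g ((?g ^^ k) a) = a"
      using funpow_left_inverse[OF finC inj[OF gA]] by blast
    show ?thesis using homomorphism_funpow[OF gD, of k] k by auto
  qed
  obtain \<sigma> where \<sigma>: "homomorphism S \<sigma> D D" "\<And>a. a \<in> C \<Longrightarrow> e (f 0 (\<sigma> a) (\<sigma> a)) = a"
    using inv[of 0] by auto
  obtain \<tau> where \<tau>: "homomorphism S \<tau> D D" "\<And>a. a \<in> C \<Longrightarrow> e (f n (\<tau> a) (\<tau> a)) = a"
    using inv[of n] by auto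
  \<comment> \<open>\<open>f 0\<close> depends only on its first argument and \<open>f n\<close>
    only on its second, so a separate correction of each argument repairs both ends at once.\<close>
  define f' where "f' = (\<lambda>i a c. e (f i (\<sigma> a) (\<tau> c)))"
  have st: "\<sigma> a \<in> ?U" "\<tau> a \<in> ?U" if "a \<in> C" for a
    using \<sigma>(1) \<tau>(1) that CU by (auto simp: homomorphism_def UD)
  have "poly_chain S n f' D"
    unfolding poly_chain_def
  proof (intro conjI ballI allI impI)
    fix i a c assume "i \<le> n" "a \<in> universe D" "c \<in> universe D"
    then show "f' i a c \<in> universe D"
      using f st by (auto simp: f'_def UD poly_chain_def C_def)
  next
    fix R s s' i us
    assume R: "R \<in> symbols S" and s: "s \<in> interp D R" "s' \<in> interp D R" and i: "i < n"
      and us: "length us = length s"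
      "\<forall>k<length s. us ! k = f' i (s ! k) (s' ! k) \<or> us ! k = f' (Suc i) (s ! k) (s' ! k)"
    have len: "length s' = length s" using finite_structureD(1)[OF D R] s by simp
    let ?s = "map \<sigma> s" and ?s' = "map \<tau> s'"
    have "?s \<in> interp D R" "?s' \<in> interp D R" using \<sigma> \<tau> R s by (auto simp: homomorphism_def)
    then have sA: "?s \<in> interp A R" "?s' \<in> interp A R" by (auto simp: D_def induced_def)
    let ?w = "\<lambda>k. if us ! k = f' i (s ! k) (s' ! k) then f i (\<sigma> (s ! k)) (\<tau> (s' ! k))
      else f (Suc i) (\<sigma> (s ! k)) (\<tau> (s' ! k))"
    let ?vs = "map ?w [0..<length s]"
    have "?vs \<in> interp A R"
      by (rule poly_chain_mix[OF f R sA i]) (use len in auto)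
    then have "map e ?vs \<in> interp D R" using eD R unfolding homomorphism_def by blast
    moreover have "map e ?vs = us"
    proof (rule nth_equalityI)
      fix k assume "k < length (map e ?vs)"
      then have k: "k < length s" by simp
      show "map e ?vs ! k = us ! k" using us(2)[rule_format, OF k] k by (auto simp: f'_def)
    qed (use us in simp)
    ultimately show "us \<in> interp D R" by simp
  qed
  moreover have "f' 0 a c = a" "f' n a c = c" if "a \<in> universe D" "c \<in> universe D" for a c
    using that \<sigma>(2) \<tau>(2) st f0[of "\<sigma> a" "\<tau> c"] fn[of "\<sigma> a" "\<tau> c"] by (auto simp: f'_def UD)
  ultimately show ?thesis using that[OF D _ eD incl] by blast
qed

text \<open>\<open>A\<close> and its core map to each other, so the same structures map to both and
  a bound for the core is one for \<open>A\<close>.\<close>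

lemma bounded_obstructions:
  fixes A :: "('r, 'a) relstruct"
  assumes S: "finite_relational_signature S"
    and A: "finite_structure S A" and f: "poly_chain S n f A" and n: "1 \<le> n"
    and f0: "\<And>a c. a \<in> universe A \<Longrightarrow> c \<in> universe A \<Longrightarrow> f 0 a c = f 0 a a"
    and fn: "\<And>a c. a \<in> universe A \<Longrightarrow> c \<in> universe A \<Longrightarrow> f n a c = f n c c"
  shows "\<exists>N. \<forall>B :: ('r, 'b) relstruct. finite_structure S B \<longrightarrow>
     (\<forall>V\<subseteq>universe B. card V \<le> N \<longrightarrow> (\<exists>h. homomorphism S h (induced B V) A)) \<longrightarrow>
     (\<exists>h. homomorphism S h B A)"
proof -
  obtain D :: "('r, 'a) relstruct" and f' h h' where D: "finite_structure S D" "poly_chain S n f' D"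
    and h: "homomorphism S h A D" and h': "homomorphism S h' D A"
    and f': "\<And>a c. a \<in> universe D \<Longrightarrow> c \<in> universe D \<Longrightarrow> f' 0 a c = a"
    "\<And>a c. a \<in> universe D \<Longrightarrow> c \<in> universe D \<Longrightarrow> f' n a c = c"
    using core_chain[OF A f n f0 fn] by metis
  obtain N where "\<forall>B :: ('r, 'b) relstruct. finite_structure S B \<longrightarrow>
     (\<forall>V\<subseteq>universe B. card V \<le> N \<longrightarrow> (\<exists>h. homomorphism S h (induced B V) D)) \<longrightarrow>
     (\<exists>h. homomorphism S h B D)"
    using bounded_obstructions_chain[OF S D n f'] by metis
  then show ?thesis using homomorphism_comp h h' by metis
qed

section \<open>Anti-identities\<close>

lemma sat_big_disj: "sat B e (big_disj ps) \<longleftrightarrow> (\<exists>p\<in>set ps. sat B e p)"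
  by (induction ps rule: big_disj.induct) auto

lemma sat_big_conj: "sat B e (big_conj ps) \<longleftrightarrow> (\<forall>p\<in>set ps. sat B e p)"
  by (induction ps rule: big_conj.induct) auto

lemma sat_foldr_Forall:
  "distinct xs \<Longrightarrow> sat B e (foldr Forall xs p) \<longleftrightarrow>
     (\<forall>e'. (\<forall>x\<in>set xs. e' x \<in> universe B) \<longrightarrow> (\<forall>x. x \<notin> set xs \<longrightarrow> e' x = e x) \<longrightarrow> sat B e' p)"
proof (induction xs arbitrary: e)
  case Nil
  have "e' = e" if "\<forall>x. e' x = e x" for e' using that by auto
  then show ?case by auto
next
  case (Cons x xs)
  show ?case
  proof
    assume L: "sat B e (foldr Forall (x # xs) p)"
    show "\<forall>e'. (\<forall>x\<in>set (x # xs). e' x \<in> universe B) \<longrightarrow> (\<forall>y. y \<notin> set (x # xs) \<longrightarrow> e' y = e y) \<longrightarrow> sat B e' p"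
    proof (intro allI impI)
      fix e' assume e': "\<forall>x\<in>set (x # xs). e' x \<in> universe B" "\<forall>y. y \<notin> set (x # xs) \<longrightarrow> e' y = e y"
      then have "sat B (e(x := e' x)) (foldr Forall xs p)" using L by simp
      then show "sat B e' p" using Cons e' by auto
    qed
  next
    assume R: "\<forall>e'. (\<forall>x\<in>set (x # xs). e' x \<in> universe B) \<longrightarrow> (\<forall>y. y \<notin> set (x # xs) \<longrightarrow> e' y = e y) \<longrightarrow> sat B e' p"
    have "sat B (e(x := u)) (foldr Forall xs p)" if u: "u \<in> universe B" for u
      unfolding Cons.IH[OF distinct.simps(2)[THEN iffD1, OF Cons.prems, THEN conjunct2]]
    proof (intro allI impI)
      fix e' assume "\<forall>x\<in>set xs. e' x \<in> universe B" "\<forall>y. y \<notin> set xs \<longrightarrow> e' y = (e(x := u)) y"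
      then show "sat B e' p" using R Cons.prems u by auto
    qed
    then show "sat B e (foldr Forall (x # xs) p)" by simp
  qed
qed

lemma Mod_anti_identity:
  assumes "distinct xs"
  shows "B \<in> Mod (foldr Forall xs (big_disj (map Neg \<alpha>s))) \<longleftrightarrow>
     (\<forall>e. (\<forall>x\<in>set xs. e x \<in> universe B) \<longrightarrow> (\<exists>\<alpha>\<in>set \<alpha>s. \<not> sat B e \<alpha>))"
  unfolding Mod_def mem_Collect_eq sat_foldr_Forall[OF assms] sat_big_disj by auto

lemma sat_atomic_hom:
  assumes "homomorphism S h B A" "atomic S \<alpha>" "sat B e \<alpha>"
  shows "sat A (h \<circ> e) \<alpha>"
  using assms unfolding homomorphism_def atomic_def by (auto simp flip: map_map)

text \<open>A violating assignment in \<open>B\<close> followed by \<open>h\<close> violates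
  \<open>q\<close> in \<open>A\<close>, because homomorphisms preserve atoms, equalities
  included.\<close>

lemma Mod_anti_identity_hom:
  assumes q: "anti_identity S q" and h: "homomorphism S h B A" and A: "A \<in> Mod q"
  shows "B \<in> Mod q"
proof -
  obtain xs \<alpha>s where q: "distinct xs" "\<forall>\<alpha>\<in>set \<alpha>s. atomic S \<alpha>" "q = foldr Forall xs (big_disj (map Neg \<alpha>s))"
    using q unfolding anti_identity_def by blast
  show ?thesis
    unfolding q(3) Mod_anti_identity[OF q(1)]
  proof (intro allI impI)
    fix e assume "\<forall>x\<in>set xs. e x \<in> universe B"
    then have "\<forall>x\<in>set xs. (h \<circ> e) x \<in> universe A" using h by (auto simp: homomorphism_def)
    then show "\<exists>\<alpha>\<in>set \<alpha>s. \<not> sat B e \<alpha>"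
      using A sat_atomic_hom[OF h] q(2) unfolding q(3) Mod_anti_identity[OF q(1)] by blast
  qed
qed

definition atoms_below :: "'r signature \<Rightarrow> nat \<Rightarrow> 'r formula set" where
  "atoms_below S N = (\<Union>R\<in>symbols S. Rel R ` tuples {..<N} (arity S R)) \<union> (\<Union>x<N. Eq x ` {..<N})"

lemma atoms_below_atomic: "\<alpha> \<in> atoms_below S N \<Longrightarrow> atomic S \<alpha> \<and> free_vars \<alpha> \<subseteq> {..<N}"
  by (auto simp: atoms_below_def atomic_def tuples_def)

lemma finite_atoms_below:
  "finite_relational_signature S \<Longrightarrow> finite (atoms_below S N)"
  unfolding atoms_below_def finite_relational_signature_def tuples_def
  by (auto intro: finite_lists_length_eq simp: conj_commute[of "length _ = _"])

text \<open>A common prefix of \<open>N\<close> variables and repetition-free lists of atoms leave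
  only finitely many candidates.\<close>

definition anti_identities_below :: "'r signature \<Rightarrow> nat \<Rightarrow> 'r formula set" where
  "anti_identities_below S N = (\<lambda>\<alpha>s. foldr Forall [0..<N] (big_disj (map Neg \<alpha>s))) `
     {\<alpha>s. \<alpha>s \<noteq> [] \<and> distinct \<alpha>s \<and> set \<alpha>s \<subseteq> atoms_below S N}"

lemma anti_identities_below:
  assumes "q \<in> anti_identities_below S N"
  shows "anti_identity S q"
proof -
  obtain \<alpha>s where \<alpha>s: "\<alpha>s \<noteq> []" "set \<alpha>s \<subseteq> atoms_below S N"
      "q = foldr Forall [0..<N] (big_disj (map Neg \<alpha>s))"
    using assms unfolding anti_identities_below_def by blast
  then have "\<forall>\<alpha>\<in>set \<alpha>s. atomic S \<alpha> \<and> free_vars \<alpha> \<subseteq> set [0..<N]"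
    using atoms_below_atomic[of _ S N] unfolding atLeast_upt by blast
  with \<alpha>s show ?thesis unfolding anti_identity_def by (metis distinct_upt)
qed

lemma finite_anti_identities_below:
  assumes "finite_relational_signature S"
  shows "finite (anti_identities_below S N)"
  unfolding anti_identities_below_def
  by (rule finite_imageI, rule finite_subset[OF _ finite_subset_distinct[OF finite_atoms_below[OF assms]]])
     auto

text \<open>If \<open>A\<close> violates the anti-identity that negates the positive diagram of \<open>V\<close>, the violating
  assignment is the homomorphism.\<close>

lemma small_induced_hom:
  assumes S: "finite_relational_signature S" and B: "finite_structure S B"
    and AB: "\<And>q. q \<in> anti_identities_below S N \<Longrightarrow> A \<in> Mod q \<Longrightarrow> B \<in> Mod q"
    and V: "V \<subseteq> universe B" "card V \<le> N"
  shows "\<exists>h. homomorphism S h (induced B V) A"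
\<comment> \<open>\<open>N\<close> may be 0, and then there is no atom to negate; for empty
  \<open>V\<close> any map works, as no symbol is nullary.\<close>
proof (cases "V = {}")
  case True
  have "[] \<notin> interp B R" if "R \<in> symbols S" for R
    using S finite_structureD(1)[OF B that, of "[]"] that by (auto simp: finite_relational_signature_def)
  then show ?thesis using True by (auto simp: homomorphism_def induced_def)
next
  case False
  have finV: "finite V" using V B by (meson finite_structure_def finite_subset)
  then have cV: "0 < card V" using False by (simp add: card_gt_0_iff)
  obtain g where g: "bij_betw g {0..<card V} V" using ex_bij_betw_nat_finite[OF finV] by blast
  \<comment> \<open>All \<open>N\<close> variables need values in \<open>V\<close>, so the surplus
    ones repeat the first element.\<close>
  define e where "e = (\<lambda>i. if i < card V then g i else g 0)"
  have eV: "e i \<in> V" for i using g cV by (auto simp: e_def bij_betw_def)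
  have "\<forall>v\<in>V. \<exists>i<N. e i = v"
  proof
    fix v assume "v \<in> V"
    then obtain i where "i < card V" "g i = v" using bij_betw_imp_surj_on[OF g] by force
    then show "\<exists>i<N. e i = v" using V(2) by (intro exI[of _ i]) (auto simp: e_def)
  qed
  then obtain idx where idx: "\<And>v. v \<in> V \<Longrightarrow> idx v < N \<and> e (idx v) = v" by metis
  let ?X = "{\<alpha> \<in> atoms_below S N. sat B e \<alpha>}"
  have "finite ?X" using finite_atoms_below[OF S] by simp
  then obtain \<alpha>s where \<alpha>s: "set \<alpha>s = ?X" "distinct \<alpha>s" using finite_distinct_list by blast
  have "0 < N" using cV V(2) by simp
  \<comment> \<open>An anti-identity has at least one disjunct; the trivial equation provides it
    even if no tuple of \<open>B\<close> lies in \<open>V\<close>.\<close>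
  then have "Eq 0 0 \<in> ?X" unfolding atoms_below_def by force
  then have "\<alpha>s \<noteq> []" using \<alpha>s by auto
  define q where "q = foldr Forall [0..<N] (big_disj (map Neg \<alpha>s))"
  have "q \<in> anti_identities_below S N"
    using \<alpha>s \<open>\<alpha>s \<noteq> []\<close> unfolding q_def anti_identities_below_def by auto
  moreover have "B \<notin> Mod q"
    unfolding q_def Mod_anti_identity[OF distinct_upt] using \<alpha>s(1) eV V(1) by blast
  ultimately have "A \<notin> Mod q" using AB by blast
  then obtain e' where e': "\<And>i. i < N \<Longrightarrow> e' i \<in> universe A" "\<And>\<alpha>. \<alpha> \<in> ?X \<Longrightarrow> sat A e' \<alpha>"
    unfolding q_def Mod_anti_identity[OF distinct_upt] \<alpha>s(1) atLeast_upt[symmetric]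
    by (metis lessThan_iff)
  have "homomorphism S (e' \<circ> idx) (induced B V) A"
    unfolding homomorphism_def
  proof (intro conjI ballI)
    show "(e' \<circ> idx) ` universe (induced B V) \<subseteq> universe A"
      using idx e'(1) by (auto simp: induced_def)
    fix R t assume R: "R \<in> symbols S" and "t \<in> interp (induced B V) R"
    then have t: "t \<in> interp B R" "set t \<subseteq> V" by (auto simp: induced_def)
    have "map e (map idx t) = t" using t(2) idx by (auto intro!: map_idI)
    then have "sat B e (Rel R (map idx t))" using t(1) by simp
    moreover have "map idx t \<in> tuples {..<N} (arity S R)"
      using t(2) idx finite_structureD(1)[OF B R t(1)] by (auto simp: tuples_def)
    ultimately have "Rel R (map idx t) \<in> ?X" using R unfolding atoms_below_def by blast
    from e'(2)[OF this] show "map (e' \<circ> idx) t \<in> interp A R" by simp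
  qed
  then show ?thesis by blast
qed

text \<open>\<open>\<psi>\<close> is the conjunction of all candidates in \<open>N\<close> variables
  that hold in \<open>A\<close>. Structures mapping to \<open>A\<close> inherit them; conversely, in
  a finite structure satisfying them every part of at most \<open>N\<close> elements maps to
  \<open>A\<close>.\<close>

lemma anti_identity_axiomatisation:
  fixes A :: "('r, 'u) relstruct"
  assumes S: "finite_relational_signature S"
    and N: "\<And>B :: ('r, 'u) relstruct. finite_structure S B \<Longrightarrow>
     (\<And>V. V\<subseteq>universe B \<Longrightarrow> card V \<le> N \<Longrightarrow> \<exists>h. homomorphism S h (induced B V) A) \<Longrightarrow>
     \<exists>h. homomorphism S h B A"
  shows "\<exists>\<psi>. conjunction_of_anti_identities S \<psi> \<and>
     (\<forall>B :: ('r, 'u) relstruct. finite_structure S B \<longrightarrow> (B \<in> Mod \<psi> \<longleftrightarrow> (\<exists>h. homomorphism S h B A)))"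
proof -
  have "finite {q \<in> anti_identities_below S N. A \<in> Mod q}"
    using finite_anti_identities_below[OF S] by simp
  then obtain ps where ps: "set ps = {q \<in> anti_identities_below S N. A \<in> Mod q}"
    using finite_list by blast
  have Mod: "B \<in> Mod (big_conj ps) \<longleftrightarrow> (\<forall>q\<in>set ps. B \<in> Mod q)" for B :: "('r, 'u) relstruct"
    by (auto simp: Mod_def sat_big_conj)
  show ?thesis
  proof (intro exI[of _ "big_conj ps"] conjI allI impI iffI)
    show "conjunction_of_anti_identities S (big_conj ps)"
      unfolding conjunction_of_anti_identities_def using ps anti_identities_below by blast
  next
    fix B :: "('r, 'u) relstruct"
    assume B: "finite_structure S B" and "B \<in> Mod (big_conj ps)"
    then show "\<exists>h. homomorphism S h B A"
      using N[OF B] small_induced_hom[OF S B, of N A] ps unfolding Mod by blast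
  next
    fix B :: "('r, 'u) relstruct"
    assume "\<exists>h. homomorphism S h B A"
    then show "B \<in> Mod (big_conj ps)"
      unfolding Mod ps using Mod_anti_identity_hom anti_identities_below by blast
  qed
qed

lemma conjunction_of_anti_identities_sentence:
  fixes S :: "'r signature"
  assumes "conjunction_of_anti_identities S \<psi>"
  shows "sentence S \<psi>"
proof -
  have all: "formula_over S (foldr Forall xs p) = formula_over S p"
    "free_vars (foldr Forall xs p) = free_vars p - set xs" for xs and p :: "'r formula"
    by (induction xs) auto
  have disj: "(\<forall>p\<in>set ps. formula_over S p \<and> free_vars p \<subseteq> X) \<Longrightarrow>
    formula_over S (big_disj ps) \<and> free_vars (big_disj ps) \<subseteq> X" for ps X
    by (induction ps rule: big_disj.induct) auto
  have conj: "(\<forall>p\<in>set ps. sentence S p) \<Longrightarrow> sentence S (big_conj ps)" for ps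
    by (induction ps rule: big_conj.induct) (auto simp: sentence_def)
  have "sentence S q" if anti: "anti_identity S q" for q
  proof -
    obtain xs \<alpha>s where q: "\<forall>\<alpha>\<in>set \<alpha>s. atomic S \<alpha> \<and> free_vars \<alpha> \<subseteq> set xs"
        "q = foldr Forall xs (big_disj (map Neg \<alpha>s))"
      using anti unfolding anti_identity_def by blast
    then show ?thesis
      using disj[of "map Neg \<alpha>s" "set xs"] by (auto simp: sentence_def all atomic_def)
  qed
  then show ?thesis using assms conj unfolding conjunction_of_anti_identities_def by blast
qed

section \<open>Isomorphic copies\<close>

lemma isomorphic_sym:
  assumes "isomorphic S B C"
  shows "isomorphic S C B"
proof -
  obtain f where f: "bij_betw f (universe B) (universe C)"
    and rel: "\<And>R xs. R \<in> symbols S \<Longrightarrow> xs \<in> tuples (universe B) (arity S R) \<Longrightarrow>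
      xs \<in> interp B R \<longleftrightarrow> map f xs \<in> interp C R"
    using assms unfolding isomorphic_def by blast
  let ?g = "inv_into (universe B) f"
  have "ys \<in> interp C R \<longleftrightarrow> map ?g ys \<in> interp B R"
    if R: "R \<in> symbols S" and ys: "ys \<in> tuples (universe C) (arity S R)" for R ys
  proof -
    have "map f (map ?g ys) = ys"
      using ys bij_betw_inv_into_right[OF f] by (auto simp: tuples_def intro!: map_idI)
    moreover have "map ?g ys \<in> tuples (universe B) (arity S R)"
      using ys bij_betwE[OF bij_betw_inv_into[OF f]] by (auto simp: tuples_def)
    ultimately show ?thesis using rel[OF R, of "map ?g ys"] by simp
  qed
  then show ?thesis using bij_betw_inv_into[OF f] unfolding isomorphic_def by blast
qed

lemma isomorphic_trans:
  assumes "isomorphic S B C" "isomorphic S C D"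
  shows "isomorphic S B D"
proof -
  obtain f where f: "bij_betw f (universe B) (universe C)"
    and relf: "\<And>R xs. R \<in> symbols S \<Longrightarrow> xs \<in> tuples (universe B) (arity S R) \<Longrightarrow>
      xs \<in> interp B R \<longleftrightarrow> map f xs \<in> interp C R"
    using assms(1) unfolding isomorphic_def by blast
  obtain g where g: "bij_betw g (universe C) (universe D)"
    and relg: "\<And>R xs. R \<in> symbols S \<Longrightarrow> xs \<in> tuples (universe C) (arity S R) \<Longrightarrow>
      xs \<in> interp C R \<longleftrightarrow> map g xs \<in> interp D R"
    using assms(2) unfolding isomorphic_def by blast
  have "xs \<in> interp B R \<longleftrightarrow> map (g \<circ> f) xs \<in> interp D R"
    if R: "R \<in> symbols S" and xs: "xs \<in> tuples (universe B) (arity S R)" for R xs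
  proof -
    have "map f xs \<in> tuples (universe C) (arity S R)"
      using xs bij_betwE[OF f] by (auto simp: tuples_def)
    then show ?thesis using relf[OF R xs] relg[OF R] by simp
  qed
  then show ?thesis using bij_betw_trans[OF f g] unfolding isomorphic_def by blast
qed

lemma isomorphic_hom:
  assumes iso: "isomorphic S B C"
    and B: "\<And>R. R \<in> symbols S \<Longrightarrow> interp B R \<subseteq> tuples (universe B) (arity S R)"
    and h: "homomorphism S h C A"
  shows "\<exists>h. homomorphism S h B A"
proof -
  obtain f where f: "bij_betw f (universe B) (universe C)"
    and rel: "\<And>R xs. R \<in> symbols S \<Longrightarrow> xs \<in> tuples (universe B) (arity S R) \<Longrightarrow>
      xs \<in> interp B R \<longleftrightarrow> map f xs \<in> interp C R"
    using iso unfolding isomorphic_def by blast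
  have "homomorphism S f B C"
    unfolding homomorphism_def using bij_betwE[OF f] rel B by blast
  then show ?thesis using homomorphism_comp h by blast
qed

text \<open>The assignments have to correspond on free variables only, since elsewhere they may
  leave the universe; for a sentence they are therefore arbitrary.\<close>

lemma sat_isomorphism:
  assumes f: "bij_betw f (universe B) (universe C)"
    and rel: "\<And>R xs. R \<in> symbols S \<Longrightarrow> xs \<in> tuples (universe B) (arity S R) \<Longrightarrow>
      xs \<in> interp B R \<longleftrightarrow> map f xs \<in> interp C R"
  shows "formula_over S p \<Longrightarrow> (\<And>v. v \<in> free_vars p \<Longrightarrow> e v \<in> universe B \<and> e' v = f (e v)) \<Longrightarrow>
    sat B e p \<longleftrightarrow> sat C e' p"
proof (induction p arbitrary: e e')
  case (Rel R xs)
  have "map e xs \<in> tuples (universe B) (arity S R)" using Rel by (auto simp: tuples_def)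
  moreover have "map f (map e xs) = map e' xs" using Rel by auto
  moreover have "R \<in> symbols S" using Rel by simp
  ultimately show ?case using rel[of R "map e xs"] unfolding sat.simps by metis
next
  case (Eq x y)
  then show ?case using f by (auto simp: bij_betw_def inj_on_def)
next
  case (Forall x p)
  have "sat B (e(x := u)) p \<longleftrightarrow> sat C (e'(x := f u)) p" if "u \<in> universe B" for u
    using Forall that by (intro Forall.IH) auto
  then show ?case unfolding sat.simps bij_betw_imp_surj_on[OF f, symmetric] by simp
next
  case (Exists x p)
  have "sat B (e(x := u)) p \<longleftrightarrow> sat C (e'(x := f u)) p" if "u \<in> universe B" for u
    using Exists that by (intro Exists.IH) auto
  then show ?case unfolding sat.simps bij_betw_imp_surj_on[OF f, symmetric] by simp
next
  case (Neg p)
  then show ?case using Neg.IH[of e e'] by simp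
next
  case (Conj p q)
  then show ?case using Conj.IH(1)[of e e'] Conj.IH(2)[of e e'] by simp
next
  case (Disj p q)
  then show ?case using Disj.IH(1)[of e e'] Disj.IH(2)[of e e'] by simp
qed simp

lemma sentence_isomorphic:
  assumes "isomorphic S B C" "sentence S p"
  shows "sat B e p \<longleftrightarrow> sat C e' p"
  using assms unfolding isomorphic_def sentence_def by (metis empty_iff sat_isomorphism)

section \<open>Sums of pieces of one structure\<close>

text \<open>A disjoint union of induced pieces of \<open>P\<close>, tagged by index. It keeps any
  number of summands in one type and lets the game compare elements of different pieces by their
  position in \<open>P\<close>.\<close>

definition layered :: "nat set \<Rightarrow> (nat \<Rightarrow> 'a set) \<Rightarrow> ('r, 'a) relstruct \<Rightarrow> ('r, nat \<times> 'a) relstruct" where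
  "layered I V P =
     \<lparr>universe = {(i, x). i \<in> I \<and> x \<in> universe P \<and> x \<in> V i},
      interp = (\<lambda>R. {map (Pair i) xs | i xs. i \<in> I \<and> xs \<in> interp P R \<and> set xs \<subseteq> V i})\<rparr>"

lemma interp_layered:
  "xs \<in> interp (layered I V P) R \<longleftrightarrow>
     (\<exists>i\<in>I. \<exists>zs. xs = map (Pair i) zs \<and> zs \<in> interp P R \<and> set zs \<subseteq> V i)"
  unfolding layered_def by auto

lemma universe_layered:
  "u \<in> universe (layered I V P) \<longleftrightarrow> fst u \<in> I \<and> snd u \<in> universe P \<and> snd u \<in> V (fst u)"
  unfolding layered_def by auto

lemma map_Pair_snd: "(\<And>p. p \<in> set xs \<Longrightarrow> fst p = i) \<Longrightarrow> map (Pair i) (map snd xs) = xs"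
  by (induction xs) (auto simp: prod_eq_iff)

lemma isomorphic_layered_singleton: "isomorphic S (layered {i} V P) (induced P (V i))"
proof -
  have "bij_betw snd (universe (layered {i} V P)) (universe (induced P (V i)))"
    by (rule bij_betw_byWitness[where f' = "Pair i"]) (auto simp: layered_def induced_def)
  moreover have "xs \<in> interp (layered {i} V P) R \<longleftrightarrow> map snd xs \<in> interp (induced P (V i)) R"
    if "xs \<in> tuples (universe (layered {i} V P)) k" for xs R k
  proof
    assume "xs \<in> interp (layered {i} V P) R"
    then show "map snd xs \<in> interp (induced P (V i)) R"
      by (auto simp: interp_layered induced_def o_def)
  next
    assume *: "map snd xs \<in> interp (induced P (V i)) R"
    have "map (Pair i) (map snd xs) = xs"
      using that by (intro map_Pair_snd) (auto simp: tuples_def universe_layered subset_iff)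
    then show "xs \<in> interp (layered {i} V P) R"
      using * unfolding interp_layered induced_def by (intro bexI[of _ i] exI[of _ "map snd xs"]) auto
  qed
  ultimately show ?thesis unfolding isomorphic_def by blast
qed

lemma isomorphic_layered_insert:
  fixes C :: "('r, 'c) relstruct" and D :: "('r, 'd) relstruct"
  assumes i: "i \<notin> F" and C: "isomorphic S (induced P (V i)) C" and D: "isomorphic S (layered F V P) D"
    and arity: "\<And>R. R \<in> symbols S \<Longrightarrow> 1 \<le> arity S R"
  shows "isomorphic S (layered (insert i F) V P) (disjoint_union C D)"
proof -
  obtain f where f: "bij_betw f (universe (induced P (V i))) (universe C)"
    and relf: "\<And>R xs. R \<in> symbols S \<Longrightarrow> xs \<in> tuples (universe (induced P (V i))) (arity S R) \<Longrightarrow>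
      xs \<in> interp (induced P (V i)) R \<longleftrightarrow> map f xs \<in> interp C R"
    using C unfolding isomorphic_def by blast
  obtain g where g: "bij_betw g (universe (layered F V P)) (universe D)"
    and relg: "\<And>R xs. R \<in> symbols S \<Longrightarrow> xs \<in> tuples (universe (layered F V P)) (arity S R) \<Longrightarrow>
      xs \<in> interp (layered F V P) R \<longleftrightarrow> map g xs \<in> interp D R"
    using D unfolding isomorphic_def by blast
  define h :: "nat \<times> 'a \<Rightarrow> 'c + 'd" where "h = (\<lambda>p. if fst p = i then Inl (f (snd p)) else Inr (g p))"
  let ?X = "layered (insert i F) V P"
  have U: "u \<in> universe ?X \<longleftrightarrow> (fst u = i \<and> snd u \<in> universe (induced P (V i))) \<or>
      (fst u \<noteq> i \<and> u \<in> universe (layered F V P))" for u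
    using i by (auto simp: universe_layered induced_def)
  have "bij_betw h (universe ?X) (universe (disjoint_union C D))"
  proof (rule bij_betw_imageI)
    show "inj_on h (universe ?X)"
    proof (rule inj_onI)
      fix u v assume uv: "u \<in> universe ?X" "v \<in> universe ?X" "h u = h v"
      show "u = v"
      proof (cases "fst u = i")
        case True
        then have "fst v = i" "f (snd u) = f (snd v)" using uv(3) by (auto simp: h_def split: if_splits)
        then show ?thesis
          using True uv(1,2) inj_onD[OF bij_betw_imp_inj_on[OF f]] unfolding U by (simp add: prod_eq_iff)
      next
        case False
        then have "fst v \<noteq> i" "g u = g v" using uv(3) by (auto simp: h_def split: if_splits)
        then show ?thesis
          using False uv(1,2) inj_onD[OF bij_betw_imp_inj_on[OF g]] unfolding U by simp
      qed
    qed
    show "h ` universe ?X = universe (disjoint_union C D)"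
    proof
      show "h ` universe ?X \<subseteq> universe (disjoint_union C D)"
      proof
        fix w assume "w \<in> h ` universe ?X"
        then obtain u where u: "w = h u" "u \<in> universe ?X" by blast
        then show "w \<in> universe (disjoint_union C D)"
          using bij_betw_apply[OF f, of "snd u"] bij_betw_apply[OF g, of u]
          unfolding U by (auto simp: h_def disjoint_union_def)
      qed
      show "universe (disjoint_union C D) \<subseteq> h ` universe ?X"
      proof
        fix w assume "w \<in> universe (disjoint_union C D)"
        then have "w \<in> Inl ` universe C \<union> Inr ` universe D" by (simp add: disjoint_union_def)
        then consider c where "w = Inl c" "c \<in> universe C" | d where "w = Inr d" "d \<in> universe D"
          by blast
        then show "w \<in> h ` universe ?X"
        proof cases
          case 1
          then obtain x where "x \<in> universe (induced P (V i))" "f x = c"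
            unfolding bij_betw_imp_surj_on[OF f, symmetric] by blast
          then show ?thesis using 1 by (intro image_eqI[of _ _ "(i, x)"]) (auto simp: U h_def)
        next
          case 2
          then obtain u where u: "u \<in> universe (layered F V P)" "g u = d"
            unfolding bij_betw_imp_surj_on[OF g, symmetric] by blast
          then have "fst u \<noteq> i" using i by (auto simp: universe_layered)
          then show ?thesis using 2 u by (intro image_eqI[of _ _ u]) (auto simp: U h_def)
        qed
      qed
    qed
  qed
  moreover have "xs \<in> interp ?X R \<longleftrightarrow> map h xs \<in> interp (disjoint_union C D) R"
    if R: "R \<in> symbols S" and xs: "xs \<in> tuples (universe ?X) (arity S R)" for R xs
  proof
    assume "xs \<in> interp ?X R"
    then obtain j zs where j: "j \<in> insert i F" "xs = map (Pair j) zs" "zs \<in> interp P R" "set zs \<subseteq> V j"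
      unfolding interp_layered by blast
    show "map h xs \<in> interp (disjoint_union C D) R"
    proof (cases "j = i")
      case True
      have "zs \<in> tuples (universe (induced P (V i))) (arity S R)"
        using xs True j(2) U by (auto simp: tuples_def)
      moreover have "zs \<in> interp (induced P (V i)) R" using j True by (simp add: induced_def)
      ultimately have "map f zs \<in> interp C R" using relf R by blast
      moreover have "map h xs = map Inl (map f zs)" using j True by (simp add: h_def)
      ultimately show ?thesis unfolding disjoint_union_def relstruct.simps by (metis UnI1 imageI)
    next
      case False
      have "xs \<in> tuples (universe (layered F V P)) (arity S R)"
        using xs False j(2) U by (auto simp: tuples_def)
      moreover have "xs \<in> interp (layered F V P) R" using j False unfolding interp_layered by blast
      ultimately have "map g xs \<in> interp D R" using relg R by blast
      moreover have "map h xs = map Inr (map g xs)" using j False by (simp add: h_def)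
      ultimately show ?thesis unfolding disjoint_union_def relstruct.simps by (metis UnI2 imageI)
    qed
  next
    assume "map h xs \<in> interp (disjoint_union C D) R"
    then have "map h xs \<in> map Inl ` interp C R \<union> map Inr ` interp D R" by (simp add: disjoint_union_def)
    then consider ys where "map h xs = map Inl ys" "ys \<in> interp C R"
      | ys where "map h xs = map Inr ys" "ys \<in> interp D R"
      by blast
    then show "xs \<in> interp ?X R"
    proof cases
      case 1
      have fst: "fst p = i" if p: "p \<in> set xs" for p
      proof -
        have "h p \<in> set (map Inl ys)" using p 1(1) by (metis image_eqI set_map)
        then show ?thesis by (auto simp: h_def split: if_splits)
      qed
      have "map h xs = map Inl (map f (map snd xs))" using fst by (auto simp: h_def)
      then have "map f (map snd xs) = ys" using 1(1) by (metis inj_Inl inj_map_eq_map)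
      moreover have "map snd xs \<in> tuples (universe (induced P (V i))) (arity S R)"
        using xs U fst by (auto simp: tuples_def)
      ultimately have "map snd xs \<in> interp (induced P (V i)) R" using relf R 1(2) by blast
      moreover have "xs = map (Pair i) (map snd xs)" using map_Pair_snd fst by metis
      ultimately show ?thesis
        unfolding interp_layered induced_def by (intro bexI[of _ i] exI[of _ "map snd xs"]) simp_all
    next
      case 2
      have fst: "fst p \<noteq> i" if p: "p \<in> set xs" for p
      proof -
        have "h p \<in> set (map Inr ys)" using p 2(1) by (metis image_eqI set_map)
        then show ?thesis by (auto simp: h_def split: if_splits)
      qed
      have "map h xs = map Inr (map g xs)" using fst by (auto simp: h_def)
      then have "map g xs = ys" using 2(1) by (metis inj_Inr inj_map_eq_map)
      moreover have "xs \<in> tuples (universe (layered F V P)) (arity S R)"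
        using xs U fst by (auto simp: tuples_def)
      ultimately have "xs \<in> interp (layered F V P) R" using relg R 2(2) by blast
      then show ?thesis unfolding interp_layered by blast
    qed
  qed
  ultimately show ?thesis unfolding isomorphic_def by blast
qed

text \<open>Binary unions are iterated, each time up to isomorphism; the index set is nonempty
  because closure under binary unions provides no empty one.\<close>

lemma belongs_to_layered:
  assumes S: "finite_relational_signature S" and K: "closed_under_disjoint_unions S K"
    and I: "finite I" "I \<noteq> {}" and V: "\<And>i. i \<in> I \<Longrightarrow> belongs_to S (induced P (V i)) K"
  shows "belongs_to S (layered I V P) K"
  using I V
proof (induction I rule: finite_ne_induct)
  case (singleton i)
  then show ?case
    using isomorphic_trans[OF isomorphic_layered_singleton] unfolding belongs_to_def by blast
next
  case (insert i F)
  obtain C where C: "C \<in> K" "isomorphic S (induced P (V i)) C"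
    using insert.prems unfolding belongs_to_def by blast
  obtain D where D: "D \<in> K" "isomorphic S (layered F V P) D"
    using insert.IH insert.prems unfolding belongs_to_def by blast
  obtain G where G: "G \<in> K" "isomorphic S (disjoint_union C D) G"
    using K C D unfolding closed_under_disjoint_unions_def belongs_to_def by blast
  have "isomorphic S (layered (insert i F) V P) (disjoint_union C D)"
    using S by (intro isomorphic_layered_insert[OF insert.hyps(3) C(2) D(2)])
      (simp add: finite_relational_signature_def)
  then show ?case using isomorphic_trans G unfolding belongs_to_def by blast
qed

section \<open>An Ehrenfeucht-Fraisse game\<close>

fun quantifier_rank :: "'r formula \<Rightarrow> nat" where
  "quantifier_rank (Neg p) = quantifier_rank p"
| "quantifier_rank (Conj p q) = max (quantifier_rank p) (quantifier_rank q)"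
| "quantifier_rank (Disj p q) = max (quantifier_rank p) (quantifier_rank q)"
| "quantifier_rank (Forall x p) = Suc (quantifier_rank p)"
| "quantifier_rank (Exists x p) = Suc (quantifier_rank p)"
| "quantifier_rank _ = 0"

text \<open>\<open>Z i\<close> and \<open>E i\<close> say whether piece \<open>i\<close> contains the first and the last level.\<close>

locale layers =
  fixes S :: "'r signature" and P :: "('r, 'a) relstruct" and lev :: "'a \<Rightarrow> nat" and n :: nat
    and Z E :: "nat \<Rightarrow> bool"
  assumes edge: "\<And>R xs x y. R \<in> symbols S \<Longrightarrow> xs \<in> interp P R \<Longrightarrow> x \<in> set xs \<Longrightarrow> y \<in> set xs \<Longrightarrow>
      lev x \<le> Suc (lev y)"
    and arity_pos: "\<And>R. R \<in> symbols S \<Longrightarrow> 1 \<le> arity S R"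
begin

definition V :: "nat \<Rightarrow> 'a set" where
  "V i = {x. (lev x = 0 \<longrightarrow> Z i) \<and> (lev x = n \<longrightarrow> E i)}"

text \<open>Levels replace distance in \<open>P\<close>: a tuple spans at most one step of levels,
  so elements far apart in level are far apart in the structure.\<close>

definition near :: "nat \<Rightarrow> 'a \<Rightarrow> 'a \<Rightarrow> bool" where
  "near g x y \<longleftrightarrow> lev x \<le> lev y + g \<and> lev y \<le> lev x + g"

text \<open>Pieces differ in their ends only, and an end can be noticed only from within
  \<open>g\<close> levels of it.\<close>

definition similar :: "nat \<Rightarrow> nat \<times> 'a \<Rightarrow> nat \<times> 'a \<Rightarrow> bool" where
  "similar g u u' \<longleftrightarrow> snd u = snd u' \<and>
     (lev (snd u) \<le> g \<longrightarrow> Z (fst u) = Z (fst u')) \<and> (n \<le> lev (snd u) + g \<longrightarrow> E (fst u) = E (fst u'))"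

text \<open>The duplicator always answers in the same position of \<open>P\<close>, only the piece may differ.
  With \<open>k\<close> moves left, a position matters to its surroundings up to \<open>2 ^ k\<close> levels away.\<close>

definition position :: "nat set \<Rightarrow> nat set \<Rightarrow> nat \<Rightarrow> nat set \<Rightarrow> (nat \<Rightarrow> nat \<times> 'a) \<Rightarrow> (nat \<Rightarrow> nat \<times> 'a) \<Rightarrow> bool" where
  "position I I' k W e e' \<longleftrightarrow> finite W \<and>
     (\<forall>s\<in>W. e s \<in> universe (layered I V P) \<and> e' s \<in> universe (layered I' V P) \<and> similar (2 ^ k) (e s) (e' s)) \<and>
     (\<forall>s\<in>W. \<forall>t\<in>W. near (2 ^ k) (snd (e s)) (snd (e t)) \<longrightarrow>
        (fst (e s) = fst (e t) \<longleftrightarrow> fst (e' s) = fst (e' t)))"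

lemma similar_sym: "similar g u u' \<Longrightarrow> similar g u' u"
  by (auto simp: similar_def)

lemma position_sym: "position I I' k W e e' \<Longrightarrow> position I' I k W e' e"
  unfolding position_def using similar_sym by (metis similar_def)

lemma extend:
  assumes pos: "position I I' (Suc k) W e e'" and u: "u \<in> universe (layered I V P)"
    and n: "2 ^ Suc k < n"
    and L: "card W < card {i \<in> I'. Z i \<and> \<not> E i}" and R: "card W < card {i \<in> I'. E i \<and> \<not> Z i}"
  obtains u' where "u' \<in> universe (layered I' V P)" "position I I' k (insert x W) (e(x := u)) (e'(x := u'))"
proof -
  have W: "finite W"
    and old: "\<And>s. s \<in> W \<Longrightarrow> e s \<in> universe (layered I V P) \<and> e' s \<in> universe (layered I' V P) \<and>
        similar (2 ^ Suc k) (e s) (e' s)"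
    and cons: "\<And>s t. s \<in> W \<Longrightarrow> t \<in> W \<Longrightarrow> near (2 ^ Suc k) (snd (e s)) (snd (e t)) \<Longrightarrow>
        (fst (e s) = fst (e t) \<longleftrightarrow> fst (e' s) = fst (e' t))"
    using pos unfolding position_def by blast+
  obtain i y where iy: "u = (i, y)" "i \<in> I" "y \<in> universe P" "y \<in> V i"
    using u by (cases u) (auto simp: universe_layered)
  have "\<exists>i'\<in>I'. y \<in> V i' \<and> similar (2 ^ k) (i, y) (i', y) \<and>
    (\<forall>t\<in>W. near (2 ^ k) y (snd (e t)) \<longrightarrow> (i = fst (e t) \<longleftrightarrow> i' = fst (e' t)))"
  proof (cases "\<exists>s\<in>W. fst (e s) = i \<and> near (2 ^ k) y (snd (e s))")
    case True
    then obtain s where s: "s \<in> W" "fst (e s) = i" "near (2 ^ k) y (snd (e s))" by blast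
    have sim: "similar (2 ^ Suc k) (e s) (e' s)" "fst (e' s) \<in> I'"
      using old[OF s(1)] by (auto simp: universe_layered)
    have "similar (2 ^ k) (i, y) (fst (e' s), y)"
      using sim s unfolding similar_def near_def by auto
    moreover have "y \<in> V (fst (e' s))"
      using sim s iy unfolding similar_def near_def V_def by auto
    moreover have "i = fst (e t) \<longleftrightarrow> fst (e' s) = fst (e' t)"
      if t: "t \<in> W" "near (2 ^ k) y (snd (e t))" for t
    proof -
      have "near (2 ^ Suc k) (snd (e s)) (snd (e t))" using s t unfolding near_def by auto
      then show ?thesis using cons[OF s(1) t(1)] s by simp
    qed
    ultimately show ?thesis using sim(2) by blast
  next
    case False
    have fresh: "\<exists>i'\<in>X. \<forall>t\<in>W. i' \<noteq> fst (e' t)" if X: "card W < card X" for X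
    proof (rule ccontr)
      assume "\<not> ?thesis"
      then have "X \<subseteq> (\<lambda>t. fst (e' t)) ` W" by auto
      then have "card X \<le> card W" using W by (meson card_image_le card_mono finite_imageI le_trans)
      then show False using X by simp
    qed
    obtain i' where i': "i' \<in> I'" "\<forall>t\<in>W. i' \<noteq> fst (e' t)" "y \<in> V i'" "similar (2 ^ k) (i, y) (i', y)"
    \<comment> \<open>As \<open>2 ^ Suc k < n\<close>, the element is within \<open>2 ^ k\<close> of
      at most one end, so a one-ended piece can imitate piece \<open>i\<close> there by having or
      lacking that end. In the middle either kind would do.\<close>
    proof (cases "if lev y \<le> 2 ^ k then Z i else \<not> (n \<le> lev y + 2 ^ k \<and> E i)")
      case True
      obtain i' where i': "i' \<in> I'" "Z i'" "\<not> E i'" "\<forall>t\<in>W. i' \<noteq> fst (e' t)" using fresh[OF L] by blast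
      show ?thesis
        by (rule that[of i']) (use True i' n iy in \<open>auto simp: V_def similar_def split: if_splits\<close>)
    next
      case False
      obtain i' where i': "i' \<in> I'" "E i'" "\<not> Z i'" "\<forall>t\<in>W. i' \<noteq> fst (e' t)" using fresh[OF R] by blast
      show ?thesis
        by (rule that[of i']) (use False i' n iy in \<open>auto simp: V_def similar_def split: if_splits\<close>)
    qed
    then show ?thesis using False by blast
  qed
  then obtain i' where i': "i' \<in> I'" "y \<in> V i'" "similar (2 ^ k) (i, y) (i', y)"
    and new: "\<And>t. t \<in> W \<Longrightarrow> near (2 ^ k) y (snd (e t)) \<Longrightarrow> (i = fst (e t) \<longleftrightarrow> i' = fst (e' t))"
    by blast
  have u': "(i', y) \<in> universe (layered I' V P)" using i' iy by (simp add: universe_layered)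
  have near_mono: "near (2 ^ k) a b \<Longrightarrow> near (2 ^ Suc k) a b" for a b unfolding near_def by auto
  have near_sym: "near g a b \<Longrightarrow> near g b a" for g a b unfolding near_def by auto
  have sim_mono: "similar (2 ^ Suc k) a b \<Longrightarrow> similar (2 ^ k) a b" for a b unfolding similar_def by auto
  have "position I I' k (insert x W) (e(x := u)) (e'(x := (i', y)))"
    unfolding position_def
  proof (intro conjI ballI impI)
    show "finite (insert x W)" using W by simp
  next
    fix s assume "s \<in> insert x W"
    then show "(e(x := u)) s \<in> universe (layered I V P)" "(e'(x := (i', y))) s \<in> universe (layered I' V P)"
      "similar (2 ^ k) ((e(x := u)) s) ((e'(x := (i', y))) s)"
      using old[of s] u u' iy(1) i'(3) sim_mono[of "e s" "e' s"] by (auto split: if_splits)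
  next
    fix s t assume st: "s \<in> insert x W" "t \<in> insert x W"
      and nr: "near (2 ^ k) (snd ((e(x := u)) s)) (snd ((e(x := u)) t))"
    show "fst ((e(x := u)) s) = fst ((e(x := u)) t) \<longleftrightarrow> fst ((e'(x := (i', y))) s) = fst ((e'(x := (i', y))) t)"
    proof (cases "s = x"; cases "t = x")
      assume "s = x" "t \<noteq> x"
      then show ?thesis using new[of t] st nr iy(1) by simp
    next
      assume "s \<noteq> x" "t = x"
      then show ?thesis using new[of s] st near_sym[OF nr] iy(1) by auto
    next
      assume "s \<noteq> x" "t \<noteq> x"
      then show ?thesis using cons[of s t] st near_mono[OF nr] by simp
    qed simp
  qed
  then show ?thesis using that u' by blast
qed

text \<open>The entries of a tuple differ by at most one level, hence are near even for
  \<open>k = 0\<close>, and so their answers share a piece. The first entry, present because arities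
  are positive, names that piece.\<close>

lemma position_interp:
  assumes pos: "position I I' k W e e'" and R: "R \<in> symbols S" and vs: "length vs = arity S R" "set vs \<subseteq> W"
    and e: "map e vs \<in> interp (layered I V P) R"
  shows "map e' vs \<in> interp (layered I' V P) R"
proof -
  obtain i zs where zs: "map e vs = map (Pair i) zs" "zs \<in> interp P R"
    using e unfolding interp_layered by blast
  have "vs \<noteq> []" using vs arity_pos[OF R] by auto
  then have hd: "hd vs \<in> set vs" by simp
  have "map snd (map e vs) = zs" unfolding zs(1) by (simp add: o_def)
  then have zs_snd: "zs = map (snd \<circ> e) vs" by simp
  have fst: "fst (e v) = i" if "v \<in> set vs" for v
  proof -
    have "e v \<in> set (map (Pair i) zs)" using that zs(1) by (metis image_eqI set_map)
    then show ?thesis by auto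
  qed
  have snd: "snd (e' v) = snd (e v)" "snd (e' v) \<in> V (fst (e' v))" "fst (e' v) \<in> I'" if "v \<in> set vs" for v
    using pos vs(2) that unfolding position_def similar_def universe_layered by auto
  have same: "fst (e' v) = fst (e' (hd vs))" if v: "v \<in> set vs" for v
  proof -
    have "lev (snd (e v)) \<le> Suc (lev (snd (e (hd vs))))" "lev (snd (e (hd vs))) \<le> Suc (lev (snd (e v)))"
      using edge[OF R zs(2)] v hd unfolding zs_snd by auto
    moreover have "(1::nat) \<le> 2 ^ k" by simp
    ultimately have "near (2 ^ k) (snd (e v)) (snd (e (hd vs)))"
      unfolding near_def by linarith
    then have "fst (e v) = fst (e (hd vs)) \<longleftrightarrow> fst (e' v) = fst (e' (hd vs))"
      using pos vs(2) v hd unfolding position_def by blast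
    then show ?thesis using fst v hd by simp
  qed
  have "map (Pair (fst (e' (hd vs)))) (map snd (map e' vs)) = map e' vs"
    using same by (intro map_Pair_snd) auto
  moreover have "map snd (map e' vs) = zs" unfolding zs_snd using snd(1) by simp
  moreover have "set zs \<subseteq> V (fst (e' (hd vs)))"
    unfolding zs_snd using snd same by (metis (no_types, lifting) comp_apply image_subsetI set_map)
  ultimately show ?thesis using zs(2) snd(3)[OF hd] unfolding interp_layered by metis
qed

lemma game:
  assumes "formula_over S p" "quantifier_rank p \<le> k" "free_vars p \<subseteq> W" "position I I' k W e e'"
    "2 ^ k < n"
    "card W + k \<le> card {i \<in> I. Z i \<and> \<not> E i}" "card W + k \<le> card {i \<in> I. E i \<and> \<not> Z i}"
    "card W + k \<le> card {i \<in> I'. Z i \<and> \<not> E i}" "card W + k \<le> card {i \<in> I'. E i \<and> \<not> Z i}"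
  shows "sat (layered I V P) e p \<longleftrightarrow> sat (layered I' V P) e' p"
  using assms
proof (induction p arbitrary: k W e e')
  case (Rel R vs)
  then show ?case
    using position_interp[of I I' k W e e' R vs] position_interp[OF position_sym, of I I' k W e e' R vs] by auto
next
  case (Eq x y)
  then have x: "x \<in> W" and y: "y \<in> W" by auto
  have s: "snd (e x) = snd (e' x)" "snd (e y) = snd (e' y)"
    using Eq.prems(4) x y unfolding position_def similar_def by auto
  \<comment> \<open>Elements at the same position of \<open>P\<close> have level distance 0, so
    \<open>position\<close> already decides whether their pieces agree.\<close>
  have "near (2 ^ k) (snd (e x)) (snd (e y))" if "snd (e x) = snd (e y)" using that by (simp add: near_def)
  then have "snd (e x) = snd (e y) \<Longrightarrow> fst (e x) = fst (e y) \<longleftrightarrow> fst (e' x) = fst (e' y)"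
    using Eq.prems(4) x y unfolding position_def by blast
  then show ?case using s by (auto simp: prod_eq_iff)
next
  case (Neg p)
  then show ?case using Neg.IH[of k W e e'] by simp
next
  case (Conj p q)
  then show ?case using Conj.IH(1)[of k W e e'] Conj.IH(2)[of k W e e'] by simp
next
  case (Disj p q)
  then show ?case using Disj.IH(1)[of k W e e'] Disj.IH(2)[of k W e e'] by simp
next
  case (Forall x p)
  obtain k' where k: "k = Suc k'" using Forall.prems(2) by (cases k) auto
  have cW: "card (insert x W) \<le> Suc (card W)" by (rule card_insert_le_m1) auto
  have step: "sat (layered I V P) (e(x := u)) p \<longleftrightarrow> sat (layered I' V P) (e'(x := u')) p"
    if "position I I' k' (insert x W) (e(x := u)) (e'(x := u'))" for u u'
    by (rule Forall.IH[OF _ _ _ that]) (use Forall.prems cW k in auto)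
  show ?case
  proof
    assume L: "sat (layered I V P) e (Forall x p)"
    show "sat (layered I' V P) e' (Forall x p)"
      unfolding sat.simps
    proof
      fix u' assume u': "u' \<in> universe (layered I' V P)"
      obtain u where u: "u \<in> universe (layered I V P)" "position I' I k' (insert x W) (e'(x := u')) (e(x := u))"
        by (rule extend[OF position_sym[OF Forall.prems(4)[unfolded k]] u', of x]) (use Forall.prems k in auto)
      show "sat (layered I' V P) (e'(x := u')) p" using step[OF position_sym[OF u(2)]] L u(1) by simp
    qed
  next
    assume L: "sat (layered I' V P) e' (Forall x p)"
    show "sat (layered I V P) e (Forall x p)"
      unfolding sat.simps
    proof
      fix u assume u: "u \<in> universe (layered I V P)"
      obtain u' where u': "u' \<in> universe (layered I' V P)" "position I I' k' (insert x W) (e(x := u)) (e'(x := u'))"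
        by (rule extend[OF Forall.prems(4)[unfolded k] u, of x]) (use Forall.prems k in auto)
      show "sat (layered I V P) (e(x := u)) p" using step[OF u'(2)] L u'(1) by simp
    qed
  qed
next
  case (Exists x p)
  obtain k' where k: "k = Suc k'" using Exists.prems(2) by (cases k) auto
  have cW: "card (insert x W) \<le> Suc (card W)" by (rule card_insert_le_m1) auto
  have step: "sat (layered I V P) (e(x := u)) p \<longleftrightarrow> sat (layered I' V P) (e'(x := u')) p"
    if "position I I' k' (insert x W) (e(x := u)) (e'(x := u'))" for u u'
    by (rule Exists.IH[OF _ _ _ that]) (use Exists.prems cW k in auto)
  show ?case
  proof
    assume "sat (layered I' V P) e' (Exists x p)"
    then obtain u' where u': "u' \<in> universe (layered I' V P)" "sat (layered I' V P) (e'(x := u')) p" by auto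
    obtain u where u: "u \<in> universe (layered I V P)" "position I' I k' (insert x W) (e'(x := u')) (e(x := u))"
      by (rule extend[OF position_sym[OF Exists.prems(4)[unfolded k]] u'(1), of x]) (use Exists.prems k in auto)
    show "sat (layered I V P) e (Exists x p)" using step[OF position_sym[OF u(2)]] u'(2) u(1) by auto
  next
    assume "sat (layered I V P) e (Exists x p)"
    then obtain u where u: "u \<in> universe (layered I V P)" "sat (layered I V P) (e(x := u)) p" by auto
    obtain u' where u': "u' \<in> universe (layered I' V P)" "position I I' k' (insert x W) (e(x := u)) (e'(x := u'))"
      by (rule extend[OF Exists.prems(4)[unfolded k] u(1), of x]) (use Exists.prems k in auto)
    show "sat (layered I' V P) e' (Exists x p)" using step[OF u'(2)] u(2) u'(1) by auto
  qed
qed simp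

end

section \<open>The pinch\<close>

abbreviation pinch_class :: "'r signature \<Rightarrow> nat \<Rightarrow> ('r, 'u) relstruct \<Rightarrow> nat \<times> 'u \<times> 'u \<Rightarrow> (nat \<times> 'u \<times> 'u) set" where
  "pinch_class S n A z \<equiv> pinch_rel S n A `` {z}"

definition pinch_level :: "(nat \<times> 'u \<times> 'u) set \<Rightarrow> nat" where
  "pinch_level c = fst (SOME z. z \<in> c)"

text \<open>Independent of the representative except on level \<open>n\<close>, where the gluing
  forgets the first coordinate; \<open>pinch_right\<close> has the same defect on level 0.\<close>

definition pinch_left :: "(nat \<times> 'u \<times> 'u) set \<Rightarrow> 'u" where
  "pinch_left c = fst (snd (SOME z. z \<in> c))"

definition pinch_right :: "(nat \<times> 'u \<times> 'u) set \<Rightarrow> 'u" where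
  "pinch_right c = snd (snd (SOME z. z \<in> c))"

lemma universe_link_product:
  "(i, a, b) \<in> universe (link_product S n A) \<longleftrightarrow> i \<le> n \<and> a \<in> universe A \<and> b \<in> universe A"
  by (auto simp: link_product_def product_def link_def)

lemma pinch_class_rep:
  assumes "z \<in> universe (link_product S n A)"
  shows "pinch_level (pinch_class S n A z) = fst z"
    and "fst z \<noteq> n \<Longrightarrow> pinch_left (pinch_class S n A z) = fst (snd z)"
    and "fst z \<noteq> 0 \<Longrightarrow> pinch_right (pinch_class S n A z) = snd (snd z)"
proof -
  have "z \<in> pinch_class S n A z" using assms by (cases z) (auto simp: pinch_rel_def)
  then have "(SOME z'. z' \<in> pinch_class S n A z) \<in> pinch_class S n A z" by (rule someI)
  then show "pinch_level (pinch_class S n A z) = fst z"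
    and "fst z \<noteq> n \<Longrightarrow> pinch_left (pinch_class S n A z) = fst (snd z)"
    and "fst z \<noteq> 0 \<Longrightarrow> pinch_right (pinch_class S n A z) = snd (snd z)"
    unfolding pinch_level_def pinch_left_def pinch_right_def by (auto simp: pinch_rel_def)
qed

lemma universe_pinch: "universe (pinch S n A) = pinch_class S n A ` universe (link_product S n A)"
  by (auto simp: pinch_def quotient_structure_def quotient_def)

lemma interp_pinch: "interp (pinch S n A) R = map (pinch_class S n A) ` interp (link_product S n A) R"
  by (simp add: pinch_def quotient_structure_def)

lemma interp_link_product:
  assumes "R \<in> symbols S"
  shows "zs \<in> interp (link_product S n A) R \<longleftrightarrow>
     (\<exists>j\<in>{1..n}. map fst zs \<in> tuples {j - 1, j} (arity S R)) \<and>
     map (fst \<circ> snd) zs \<in> interp A R \<and> map (snd \<circ> snd) zs \<in> interp A R"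
  using assms by (simp add: link_product_def product_def link_def)

lemma link_product_tuples:
  assumes A: "finite_structure S A" and R: "R \<in> symbols S" and zs: "zs \<in> interp (link_product S n A) R"
  shows "length zs = arity S R" "set zs \<subseteq> universe (link_product S n A)"
proof -
  obtain j where j: "j \<in> {1..n}" "map fst zs \<in> tuples {j - 1, j} (arity S R)"
    and z: "map (fst \<circ> snd) zs \<in> interp A R" "map (snd \<circ> snd) zs \<in> interp A R"
    using zs unfolding interp_link_product[OF R] by blast
  show "length zs = arity S R" using j(2) by (simp add: tuples_def)
  show "set zs \<subseteq> universe (link_product S n A)"
  proof
    fix z assume z': "z \<in> set zs"
    have "fst z \<in> {j - 1, j}" using j(2) z' unfolding tuples_def by auto
    then have "fst z \<le> n" using j(1) by auto
    moreover have "fst (snd z) \<in> universe A" "snd (snd z) \<in> universe A"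
      using finite_structureD(2)[OF A R z(1)] finite_structureD(2)[OF A R z(2)] z' by auto
    ultimately show "z \<in> universe (link_product S n A)"
      by (cases z) (simp add: universe_link_product)
  qed
qed

lemma pinch_tuples:
  assumes A: "finite_structure S A" and R: "R \<in> symbols S"
  shows "interp (pinch S n A) R \<subseteq> tuples (universe (pinch S n A)) (arity S R)"
  using link_product_tuples[OF A R, of _ n] by (fastforce simp: interp_pinch universe_pinch tuples_def)

text \<open>Off the last level the first coordinates of the representatives can be read off from the
  classes, and they form a tuple of \<open>A\<close>. This makes \<open>pinch_left\<close> a
  homomorphism on \<open>B_L\<close>, and likewise \<open>pinch_right\<close> on
  \<open>B_R\<close>.\<close>

lemma pinch_tuple_reps:
  assumes A: "finite_structure S A" and R: "R \<in> symbols S" and xs: "xs \<in> interp (pinch S n A) R"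
  obtains zs where "zs \<in> interp (link_product S n A) R" "xs = map (pinch_class S n A) zs"
    "map pinch_level xs = map fst zs"
    "\<forall>x\<in>set xs. pinch_level x \<noteq> n \<Longrightarrow> map pinch_left xs = map (fst \<circ> snd) zs"
    "\<forall>x\<in>set xs. pinch_level x \<noteq> 0 \<Longrightarrow> map pinch_right xs = map (snd \<circ> snd) zs"
proof -
  obtain zs where zs: "zs \<in> interp (link_product S n A) R" "xs = map (pinch_class S n A) zs"
    using xs by (auto simp: interp_pinch)
  have rep: "z \<in> universe (link_product S n A)" if "z \<in> set zs" for z
    using link_product_tuples(2)[OF A R zs(1)] that by blast
  show ?thesis
    by (rule that[OF zs]) (auto simp: zs(2) pinch_class_rep rep)
qed

lemma layers_pinch:
  assumes S: "finite_relational_signature S" and A: "finite_structure S A"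
  shows "layers S (pinch S n A) pinch_level"
proof
  show "1 \<le> arity S R" if "R \<in> symbols S" for R using S that by (simp add: finite_relational_signature_def)
  fix R xs x y
  assume R: "R \<in> symbols S" and xs: "xs \<in> interp (pinch S n A) R" and xy: "x \<in> set xs" "y \<in> set xs"
  obtain zs where zs: "zs \<in> interp (link_product S n A) R" "map pinch_level xs = map fst zs"
    using pinch_tuple_reps[OF A R xs] by metis
  then obtain j where "map pinch_level xs \<in> tuples {j - 1, j} (arity S R)"
    unfolding interp_link_product[OF R] by metis
  then have "pinch_level x \<in> {j - 1, j}" "pinch_level y \<in> {j - 1, j}" using xy by (auto simp: tuples_def)
  then show "pinch_level x \<le> Suc (pinch_level y)" by auto
qed

lemma induced_cong:
  assumes "\<And>R. \<forall>xs\<in>interp B R. set xs \<subseteq> universe B"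
    and "\<And>x. x \<in> universe B \<Longrightarrow> x \<in> V \<longleftrightarrow> x \<in> W"
  shows "induced B V = induced B W"
proof -
  have "{xs \<in> interp B R. set xs \<subseteq> V} = {xs \<in> interp B R. set xs \<subseteq> W}" for R
    using assms by blast
  moreover have "universe B \<inter> V = universe B \<inter> W" using assms(2) by blast
  ultimately show ?thesis by (simp add: induced_def)
qed

lemma pinch_interp_universe:
  assumes "finite_structure S A"
  shows "\<forall>xs\<in>interp (pinch S n A) R. set xs \<subseteq> universe (pinch S n A)"
proof (cases "R \<in> symbols S")
  case True
  then show ?thesis using pinch_tuples[OF assms True, of n] by (auto simp: tuples_def)
next
  case False
  then have "interp A R = {}" using assms by (simp add: finite_structure_def)
  then show ?thesis
    by (auto simp: interp_pinch link_product_def product_def)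
qed

lemma pinch_L_levels:
  assumes "finite_structure S A"
  shows "pinch_L S n A = induced (pinch S n A) {c. pinch_level c \<noteq> n}"
  unfolding pinch_L_def
proof (rule induced_cong)
  fix c assume "c \<in> universe (pinch S n A)"
  then obtain k a b where "c = pinch_class S n A (k, a, b)" "(k, a, b) \<in> universe (link_product S n A)"
    unfolding universe_pinch by auto
  then show "c \<in> {pinch_class S n A (k, a, b) |k a b. (k, a, b) \<in> universe (link_product S n A) \<and> k \<noteq> n} \<longleftrightarrow>
      c \<in> {c. pinch_level c \<noteq> n}"
    using pinch_class_rep(1)[of _ S n A] by fastforce
qed (rule pinch_interp_universe[OF assms])

lemma pinch_R_levels:
  assumes "finite_structure S A"
  shows "pinch_R S n A = induced (pinch S n A) {c. pinch_level c \<noteq> 0}"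
  unfolding pinch_R_def
proof (rule induced_cong)
  fix c assume "c \<in> universe (pinch S n A)"
  then obtain k a b where "c = pinch_class S n A (k, a, b)" "(k, a, b) \<in> universe (link_product S n A)"
    unfolding universe_pinch by auto
  then show "c \<in> {pinch_class S n A (k, a, b) |k a b. (k, a, b) \<in> universe (link_product S n A) \<and> k \<noteq> 0} \<longleftrightarrow>
      c \<in> {c. pinch_level c \<noteq> 0}"
    using pinch_class_rep(1)[of _ S n A] by fastforce
qed (rule pinch_interp_universe[OF assms])

section \<open>Homomorphisms from the pinch\<close>

lemma pinch_hom_chain:
  assumes A: "finite_structure S A" and n: "1 \<le> n" and G: "homomorphism S G (pinch S n A) A"
  defines "f \<equiv> \<lambda>i a b. G (pinch_class S n A (i, a, b))"
  shows "poly_chain S n f A"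
    and "\<And>a c. a \<in> universe A \<Longrightarrow> c \<in> universe A \<Longrightarrow> f 0 a c = f 0 a a"
    and "\<And>a c. a \<in> universe A \<Longrightarrow> c \<in> universe A \<Longrightarrow> f n a c = f n c c"
proof -
  show "poly_chain S n f A"
    unfolding poly_chain_def
  proof (intro conjI ballI allI impI)
    fix i a c assume "i \<le> n" "a \<in> universe A" "c \<in> universe A"
    then have "pinch_class S n A (i, a, c) \<in> universe (pinch S n A)"
      unfolding universe_pinch by (intro imageI) (simp add: universe_link_product)
    then show "f i a c \<in> universe A" using G unfolding homomorphism_def f_def by blast
  next
    fix R s s' i us
    assume R: "R \<in> symbols S" and s: "s \<in> interp A R" "s' \<in> interp A R" and i: "i < n"
      and us: "length us = length s"
        "\<forall>k<length s. us ! k = f i (s ! k) (s' ! k) \<or> us ! k = f (Suc i) (s ! k) (s' ! k)"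
    have len: "length s = arity S R" "length s' = arity S R"
      using finite_structureD(1)[OF A R] s by simp_all
    \<comment> \<open>Records which of the two levels produced each entry. A tuple through levels
      \<open>i\<close> and \<open>Suc i\<close> in any pattern belongs to the link, which is the
      origin of free mixing.\<close>
    define lv where "lv = (\<lambda>k. if us ! k = f i (s ! k) (s' ! k) then i else Suc i)"
    define zs where "zs = map (\<lambda>k. (lv k, s ! k, s' ! k)) [0..<arity S R]"
    have "map (fst \<circ> snd) zs = s" "map (snd \<circ> snd) zs = s'"
      using len by (auto simp: zs_def o_def intro!: nth_equalityI)
    moreover have "map fst zs \<in> tuples {Suc i - 1, Suc i} (arity S R)"
      by (auto simp: zs_def tuples_def lv_def)
    moreover have "Suc i \<in> {1..n}" using i by simp
    ultimately have "zs \<in> interp (link_product S n A) R"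
      using s unfolding interp_link_product[OF R] by metis
    then have "map G (map (pinch_class S n A) zs) \<in> interp A R"
      using G R unfolding homomorphism_def interp_pinch by blast
    moreover have "map G (map (pinch_class S n A) zs) = us"
    proof (rule nth_equalityI)
      fix k assume "k < length (map G (map (pinch_class S n A) zs))"
      then have k: "k < arity S R" by (simp add: zs_def)
      then have "map G (map (pinch_class S n A) zs) ! k = f (lv k) (s ! k) (s' ! k)"
        by (simp add: zs_def f_def)
      then show "map G (map (pinch_class S n A) zs) ! k = us ! k"
        using us(2) k len by (auto simp: lv_def)
    qed (use us len in \<open>simp add: zs_def\<close>)
    ultimately show "us \<in> interp A R" by simp
  qed
next
  fix a c assume "a \<in> universe A" "c \<in> universe A"
  then have "((0, a, c), (0, a, a)) \<in> pinch_rel S n A" "((n, a, c), (n, c, c)) \<in> pinch_rel S n A"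
    by (auto simp: pinch_rel_def universe_link_product)
  then show "f 0 a c = f 0 a a" "f n a c = f n c c"
    unfolding f_def by (simp_all add: equiv_class_eq[OF equiv_pinch_rel[OF n]])
qed

lemma odd_even_card:
  "M \<le> card {i \<in> {1..2 * M}. odd i}" "M \<le> card {i \<in> {1..2 * M}. even (i::nat)}"
proof -
  have "card ((\<lambda>j. 2 * j + 1) ` {..<M}) \<le> card {i \<in> {1..2 * M}. odd i}"
    by (rule card_mono) auto
  then show "M \<le> card {i \<in> {1..2 * M}. odd i}" by (simp add: card_image inj_on_def)
  have "card ((\<lambda>j. 2 * j + 2) ` {..<M}) \<le> card {i \<in> {1..2 * M}. even i}"
    by (rule card_mono) auto
  then show "M \<le> card {i \<in> {1..2 * M}. even i}" by (simp add: card_image inj_on_def)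
qed

lemma fo_pinch_hom:
  fixes A :: "('r, 'u) relstruct" and K :: "('r, 'u) relstruct set"
  assumes S: "finite_relational_signature S" and K: "\<And>B. B \<in> K \<Longrightarrow> finite_structure S B"
    and AK: "A \<in> K" and pinch: "closed_under_pinch S K {A}" and union: "closed_under_disjoint_unions S K"
    and \<phi>: "sentence S \<phi>" "hom_class S K A = K \<inter> Mod \<phi>"
  shows "\<exists>n\<ge>1. \<exists>G. homomorphism S G (pinch S n A) A"
proof -
  define q where "q = quantifier_rank \<phi>"
  \<comment> \<open>The shortest pinch that the game with \<open>q\<close> moves admits.\<close>
  define n :: nat where "n = 2 ^ q + 1"
  \<comment> \<open>\<open>q\<close> pieces of each kind suffice for the game; one more keeps the
    sum nonempty when \<open>q = 0\<close>.\<close>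
  define M where "M = Suc q"
  \<comment> \<open>Odd pieces are copies of \<open>B_L\<close>, positive even ones copies of
    \<open>B_R\<close>. Piece 0 has both ends and is the whole pinch, so \<open>?Y\<close> is
    \<open>?X\<close> with one pinch added.\<close>
  define Z :: "nat \<Rightarrow> bool" where "Z = (\<lambda>i. i = 0 \<or> odd i)"
  define E :: "nat \<Rightarrow> bool" where "E = even"
  let ?P = "pinch S n A" and ?I = "{1..2 * M}" and ?I' = "{0..2 * M}"
  have A: "finite_structure S A" by (rule K[OF AK])
  interpret layers S ?P pinch_level n Z E by (rule layers_pinch[OF S A])
  let ?X = "layered ?I V ?P" and ?Y = "layered ?I' V ?P"
  have V: "V i = (if i = 0 then UNIV else if odd i then {c. pinch_level c \<noteq> n} else {c. pinch_level c \<noteq> 0})" for i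
    unfolding V_def by (auto simp: Z_def E_def)
  have n: "1 \<le> n" by (simp add: n_def)
  then have "belongs_to S ?P K" "belongs_to S (pinch_L S n A) K" "belongs_to S (pinch_R S n A) K"
    using pinch unfolding closed_under_pinch_def by blast+
  moreover have "induced ?P UNIV = ?P" by (simp add: induced_def)
  ultimately have "belongs_to S (induced ?P (V i)) K" for i
    unfolding V pinch_L_levels[OF A] pinch_R_levels[OF A] by simp
  then have "belongs_to S ?X K" "belongs_to S ?Y K"
    by (auto intro!: belongs_to_layered[OF S union] simp: M_def)
  then obtain X Y where X: "X \<in> K" "isomorphic S ?X X" and Y: "Y \<in> K" "isomorphic S ?Y Y"
    unfolding belongs_to_def by blast

  \<comment> \<open>Each piece is projected to the coordinate that survives the gluing at the end it
    has.\<close>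
  define h where "h = (\<lambda>(i :: nat, c :: (nat \<times> 'u \<times> 'u) set). if odd i then pinch_left c else pinch_right c)"
  have "homomorphism S h ?X A"
    unfolding homomorphism_def
  proof (intro conjI ballI)
    show "h ` universe ?X \<subseteq> universe A"
    proof
      fix a assume "a \<in> h ` universe ?X"
      then obtain i c where ic: "a = h (i, c)" "i \<in> ?I" "c \<in> universe ?P" "c \<in> V i"
        by (auto simp: universe_layered)
      then obtain z where z: "z \<in> universe (link_product S n A)" "c = pinch_class S n A z"
        by (auto simp: universe_pinch)
      then show "a \<in> universe A"
        using ic pinch_class_rep[OF z(1)] by (cases z) (auto simp: h_def V universe_link_product)
    qed
    fix R xs assume R: "R \<in> symbols S" and "xs \<in> interp ?X R"
    then obtain i cs where i: "i \<in> ?I" "xs = map (Pair i) cs" "cs \<in> interp ?P R" "set cs \<subseteq> V i"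
      by (auto simp: interp_layered)
    obtain zs where zs: "zs \<in> interp (link_product S n A) R"
      "\<forall>x\<in>set cs. pinch_level x \<noteq> n \<Longrightarrow> map pinch_left cs = map (fst \<circ> snd) zs"
      "\<forall>x\<in>set cs. pinch_level x \<noteq> 0 \<Longrightarrow> map pinch_right cs = map (snd \<circ> snd) zs"
      using pinch_tuple_reps[OF A R i(3)] by metis
    have "map h xs = (if odd i then map pinch_left cs else map pinch_right cs)"
      using i(2) by (simp add: h_def)
    also have "\<dots> = (if odd i then map (fst \<circ> snd) zs else map (snd \<circ> snd) zs)"
      using zs(2,3) i(1,4) by (auto simp: V subset_iff simp del: map_eq_conv)
    also have "\<dots> \<in> interp A R" using zs(1) unfolding interp_link_product[OF R] by simp
    finally show "map h xs \<in> interp A R" .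
  qed
  then have "X \<in> hom_class S K A"
    using isomorphic_hom[OF isomorphic_sym[OF X(2)]] X(1) K[OF X(1)]
    unfolding hom_class_def finite_structure_def by blast
  then have "sat X e \<phi>" for e using \<phi>(2) by (auto simp: Mod_def)
  then have satX: "sat ?X e \<phi>" for e using sentence_isomorphic[OF X(2) \<phi>(1)] by blast

  have sub: "{i \<in> ?I. odd i} \<subseteq> {i \<in> ?I. Z i \<and> \<not> E i}" "{i \<in> ?I. even i} \<subseteq> {i \<in> ?I. E i \<and> \<not> Z i}"
    "{i \<in> ?I. odd i} \<subseteq> {i \<in> ?I'. Z i \<and> \<not> E i}" "{i \<in> ?I. even i} \<subseteq> {i \<in> ?I'. E i \<and> \<not> Z i}"
    by (auto simp: Z_def E_def)
  have cards: "M \<le> card {i \<in> ?I. Z i \<and> \<not> E i}" "M \<le> card {i \<in> ?I. E i \<and> \<not> Z i}"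
    "M \<le> card {i \<in> ?I'. Z i \<and> \<not> E i}" "M \<le> card {i \<in> ?I'. E i \<and> \<not> Z i}"
    by (rule order_trans[OF odd_even_card(1) card_mono[OF _ sub(1)]]
        order_trans[OF odd_even_card(2) card_mono[OF _ sub(2)]]
        order_trans[OF odd_even_card(1) card_mono[OF _ sub(3)]]
        order_trans[OF odd_even_card(2) card_mono[OF _ sub(4)]], simp)+
  have "position ?I ?I' q {} e e" for e by (simp add: position_def)
  moreover have "q \<le> M" "2 ^ q < n" by (simp_all add: M_def n_def)
  ultimately have "sat ?X e \<phi> \<longleftrightarrow> sat ?Y e \<phi>" for e
    using \<phi>(1) cards by (intro game[where k = q and W = "{}"]) (auto simp: sentence_def q_def[symmetric])
  then have "sat Y e \<phi>" for e using satX sentence_isomorphic[OF Y(2) \<phi>(1)] by blast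
  then have "Y \<in> hom_class S K A" using \<phi>(2) Y(1) by (simp add: Mod_def)
  then obtain g where g: "homomorphism S g Y A" unfolding hom_class_def by blast
  have "interp ?Y R \<subseteq> tuples (universe ?Y) (arity S R)" if R: "R \<in> symbols S" for R
  proof
    fix xs assume "xs \<in> interp ?Y R"
    then obtain i zs where "i \<in> ?I'" "xs = map (Pair i) zs" "zs \<in> interp ?P R" "set zs \<subseteq> V i"
      unfolding interp_layered by blast
    then show "xs \<in> tuples (universe ?Y) (arity S R)"
      using pinch_tuples[OF A R, of n] by (auto simp: tuples_def universe_layered subset_iff)
  qed
  then obtain g' where g': "homomorphism S g' ?Y A" using isomorphic_hom[OF Y(2) _ g] by blast
  have "homomorphism S (Pair 0) ?P ?Y"
    unfolding homomorphism_def
  proof (intro conjI ballI)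
    show "Pair 0 ` universe ?P \<subseteq> universe ?Y" by (auto simp: universe_layered V)
    fix R xs assume "xs \<in> interp ?P R"
    then show "map (Pair 0) xs \<in> interp ?Y R" unfolding interp_layered by (auto simp: V)
  qed
  from homomorphism_comp[OF this g'] have "\<exists>G. homomorphism S G ?P A" by blast
  with n show ?thesis by blast
qed

theorem theorem4p8:
  fixes S :: "'r signature"
    and K :: "('r, 'u) relstruct set"
    and A :: "('r, 'u) relstruct"
  assumes "finite_relational_signature S"
    and "\<And>B. B \<in> K \<Longrightarrow> finite_structure S B"
    and "A \<in> K"
    and "closed_under_pinch S K {A}"
    and "closed_under_disjoint_unions S K"
  shows "(\<exists>\<phi>. sentence S \<phi> \<and> hom_class S K A = K \<inter> Mod \<phi>) \<longleftrightarrow>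
         (\<exists>\<psi>. conjunction_of_anti_identities S \<psi> \<and> hom_class S K A = K \<inter> Mod \<psi>)"
proof
  assume "\<exists>\<phi>. sentence S \<phi> \<and> hom_class S K A = K \<inter> Mod \<phi>"
  then obtain n G where n: "1 \<le> n" and G: "homomorphism S G (pinch S n A) A"
    using fo_pinch_hom[OF assms] by blast
  have A: "finite_structure S A" using assms by blast
  obtain N where N: "\<forall>B :: ('r, 'u) relstruct. finite_structure S B \<longrightarrow>
     (\<forall>V\<subseteq>universe B. card V \<le> N \<longrightarrow> (\<exists>h. homomorphism S h (induced B V) A)) \<longrightarrow>
     (\<exists>h. homomorphism S h B A)"
    using bounded_obstructions[OF assms(1) A pinch_hom_chain(1)[OF A n G] n
        pinch_hom_chain(2,3)[OF A n G]] by blast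
  obtain \<psi> where "conjunction_of_anti_identities S \<psi>"
    and \<psi>: "\<And>B :: ('r, 'u) relstruct. finite_structure S B \<Longrightarrow> B \<in> Mod \<psi> \<longleftrightarrow> (\<exists>h. homomorphism S h B A)"
    using anti_identity_axiomatisation[OF assms(1), of N A] N by metis
  \<comment> \<open>\<open>\<psi>\<close> is correct for every finite structure, so only the
    restriction to \<open>K\<close> remains.\<close>
  moreover have "hom_class S K A = K \<inter> Mod \<psi>"
    using \<psi> assms(2) unfolding hom_class_def by blast
  ultimately show "\<exists>\<psi>. conjunction_of_anti_identities S \<psi> \<and> hom_class S K A = K \<inter> Mod \<psi>" by blast
next
  assume "\<exists>\<psi>. conjunction_of_anti_identities S \<psi> \<and> hom_class S K A = K \<inter> Mod \<psi>"
  then show "\<exists>\<phi>. sentence S \<phi> \<and> hom_class S K A = K \<inter> Mod \<phi>"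
    using conjunction_of_anti_identities_sentence by blast
qed

end
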